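(* Let $n\ge 2$ be an integer, let $0\le i_1<i_2\le n$ be integers, and set $d=i_2-i_1$. Let $c_{i_1},c_{i_2}$ be non-zero complex numbers and parametrize $\mathbb{C}^{n-1}$ by the coordinate variables $c_i$, $0\le i\le n$, $i\ne i_1,i_2$; write $\vec c$ for the tuple of these variables. Let $$g(z)=1+\frac{c_{i_2}}{c_{i_1}}z^d,\qquad f(z)=g(z)+\sum_{0\le i\le n,\ i\ne i_1,i_2}c_i z^{i-i_1}\qquad (z\in L),$$ and let $\phi:U\to L$ be a smooth function, where $U\subset\mathbb{C}^{n-1}$ is a neighborhood of $\vec 0$, such that $f(\phi(\vec c))=0$ for $\vec c\in U$ and $\phi(\vec 0)=\alpha$, where $g(\alpha)=0$. Denote by $\frac{\vec c}{c_{i_1}}\in\mathbb{C}^{n-1}$ the tuple with entries $c_i/c_{i_1}$, $i\neq i_1,i_2$. Then, as formal series, the Taylor series of $\phi\big(\frac{\vec c}{c_{i_1}}\big)$ about $\vec 0$ with respect to the variables $c_i$, $i\ne i_1,i_2$, is equal to $X_{i_1,i_2,\xi}$, where we identify $c_i=a_i$ for all $0\le i\le n$ and $$\alpha=\xi\,\frac{a_{i_1}^{1/d}}{a_{i_2}^{1/d}},\qquad \xi^d=-1 .$$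
   Context: Riemann surface of the logarithm: $L=\{(r,\theta,m): r\in\mathbb{R}^+,\theta\in(-\pi,\pi],m\in\mathbb{Z}\}$, with $z^\gamma=e^{\gamma\ln r+i\gamma\theta+2\pi i m\gamma}\in\mathbb{C}$ for $z=(r,\theta,m)\in L$ and $\gamma\in\mathbb{C}$ (here $i=\sqrt{-1}$), with its usual complex structure; derivatives (Taylor series) of an $L$-valued function, and the equation displayed for $\alpha$, are understood through the local coordinate $z\mapsto z^1=re^{i\theta}\in\mathbb{C}$. "Smooth" means differentiable to all orders in the complex coordinate variables. Falling factorial: $(x)_k=\prod_{i=1}^k(x-i+1)$ for an integer $k\ge 0$. For an integer $v$ and a rational number $u$, define $$\gamma(u,v)=\begin{cases}1&\text{if }v=0,\\ (u)_{|v|}&\text{if }v<0,\\ 0&\text{if }v>0,\ u\in\mathbb{Z}\text{ and }0>u\ge -v,\\ \dfrac{1}{\prod_{i=1}^v(u+i)}&\text{otherwise.}\end{cases}$$ Let $\mathscr{L}$ be the set of $(v_0,\dots,v_n)\in\mathbb{Z}^{n+1}$ with $\sum_{i=0}^n i\,v_i=0$ and $\sum_{i=0}^n v_i=0$. For $u_0,\dots,u_n\in\mathbb{Q}$ define the bracket series $$[a_0^{u_0}a_1^{u_1}\cdots a_n^{u_n}]=\sum_{(v_0,\dots,v_n)\in\mathscr{L}}\ \prod_{i=0}^n\gamma(u_i,v_i)\,a_i^{u_i+v_i},$$ where variables not displayed in a bracket have $u_i=0$; the $a_i$ and their fractional powers are treated as indeterminates. For a $d$-th root $\xi$ of $-1$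 define $$X_{i_1,i_2,\xi}=\xi\,[a_{i_1}^{1/d}a_{i_2}^{-1/d}]+\frac1d\sum_{k=2}^d\xi^k\,[a_{i_1}^{(k-d)/d}a_{i_1+k-1}a_{i_2}^{-k/d}]+\frac1d\,[a_{i_1-1}a_{i_1}^{-1}],$$ where $[a_{i_1-1}a_{i_1}^{-1}]$ denotes $0$ if $i_1=0$. Here $X_{i_1,i_2,\xi}$ is regarded as a power series in the $a_i$, $i\neq i_1,i_2$, with coefficients depending on $a_{i_1},a_{i_2}$. *)

theory Defs
  imports "HOL-Analysis.Analysis"
begin

definition log_surface :: "(real \<times> real \<times> int) set" where
  "log_surface = {(r, \<theta>, m). 0 < r \<and> - pi < \<theta> \<and> \<theta> \<le> pi}"

fun log_coord :: "real \<times> real \<times> int \<Rightarrow> complex" where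
  "log_coord (r, \<theta>, m) = of_real (ln r) + \<i> * of_real \<theta> + 2 * of_real pi * \<i> * of_int m"

fun lpow :: "real \<times> real \<times> int \<Rightarrow> complex \<Rightarrow> complex" where
  "lpow (r, \<theta>, m) \<gamma> =
     exp (\<gamma> * of_real (ln r) + \<i> * \<gamma> * of_real \<theta> + 2 * of_real pi * \<i> * of_int m * \<gamma>)"

text \<open>
  The usual topology: the logarithm maps the surface bijectively onto the plane, and sheet \<open>m\<close> is
  glued to sheet \<open>m + 1\<close> along \<open>\<theta> = pi\<close>. This is not the subspace topology of
  \<open>real \<times> real \<times> int\<close>.
\<close>

definition log_surface_topology :: "(real \<times> real \<times> int) topology" where
  "log_surface_topology = pullback_topology log_surface log_coord euclidean"

definition cpartial ::
    "'k::finite \<Rightarrow> (complex^'k \<Rightarrow> complex) \<Rightarrow> complex^'k \<Rightarrow> complex" where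
  "cpartial j F c = deriv (\<lambda>t. F (c + axis j t)) 0"

primrec cpartials ::
    "'k::finite list \<Rightarrow> (complex^'k \<Rightarrow> complex) \<Rightarrow> complex^'k \<Rightarrow> complex" where
  "cpartials [] F = F"
| "cpartials (j # js) F = cpartial j (cpartials js F)"

text \<open>Complex differentiability is Frechet differentiability with complex-linear derivative.\<close>

definition csmooth_on :: "(complex^'k::finite) set \<Rightarrow> (complex^'k \<Rightarrow> complex) \<Rightarrow> bool" where
  "csmooth_on U F \<longleftrightarrow>
     (\<forall>js. \<forall>c\<in>U. \<exists>D. (cpartials js F has_derivative D) (at c) \<and> (\<forall>s x. D (s *s x) = s * D x))"

text \<open>
  On the surface \<open>lpow z 1\<close> is only a local coordinate, so smoothness of a map into the surface
  also requires continuity: a map may jump between sheets without \<open>lpow z 1\<close> noticing.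
\<close>

definition smooth_to_log_surface ::
    "(complex^'k::finite) set \<Rightarrow> (complex^'k \<Rightarrow> real \<times> real \<times> int) \<Rightarrow> bool" where
  "smooth_to_log_surface U \<phi> \<longleftrightarrow>
     continuous_map (top_of_set U) log_surface_topology \<phi> \<and> csmooth_on U (\<lambda>c. lpow (\<phi> c) 1)"

text \<open>
  The partial derivatives of a smooth function commute, so the order of differentiation picked by
  the choice operator does not matter.
\<close>

definition taylor_coeff :: "(complex^'k::finite \<Rightarrow> complex) \<Rightarrow> ('k \<Rightarrow> nat) \<Rightarrow> complex" where
  "taylor_coeff F m =
     cpartials (SOME js. count_list js = m) F 0 / (\<Prod>j\<in>UNIV. fact (m j))"

text \<open>
  A formal series in variables \<open>a\<^sub>0, a\<^sub>1, \<dots>\<close> with rational exponents is the function that maps an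
  exponent vector \<open>e :: nat \<Rightarrow> rat\<close> to the coefficient of the monomial with these exponents. The
  \<open>j\<close>-th coordinate of the argument of \<open>F\<close> is the variable with number \<open>idx j\<close>. The sum has at most
  one term: the Taylor coefficient if \<open>e\<close> is a multi-index in these variables.
\<close>

definition taylor_series ::
    "('k::finite \<Rightarrow> nat) \<Rightarrow> (complex^'k \<Rightarrow> complex) \<Rightarrow> (nat \<Rightarrow> rat) \<Rightarrow> complex" where
  "taylor_series idx F e =
     (\<Sum>m | (\<forall>j. e (idx j) = of_nat (m j)) \<and> (\<forall>i. i \<notin> range idx \<longrightarrow> e i = 0). taylor_coeff F m)"

definition falling_factorial :: "rat \<Rightarrow> nat \<Rightarrow> rat" where
  "falling_factorial x k = (\<Prod>i=1..k. x - of_nat i + 1)"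

definition gamma_factor :: "rat \<Rightarrow> int \<Rightarrow> rat" where
  "gamma_factor u v =
     (if v = 0 then 1
      else if v < 0 then falling_factorial u (nat \<bar>v\<bar>)
      else if u \<in> \<int> \<and> 0 > u \<and> u \<ge> - of_int v then 0
      else 1 / (\<Prod>i=1..nat v. u + of_nat i))"

definition relation_lattice :: "nat \<Rightarrow> (nat \<Rightarrow> int) set" where
  "relation_lattice n =
     {v. (\<forall>i>n. v i = 0) \<and> (\<Sum>i=0..n. int i * v i) = 0 \<and> (\<Sum>i=0..n. v i) = 0}"

text \<open>The coefficient at \<open>e\<close> of the bracket series; at most one \<open>v\<close> contributes.\<close>

definition bracket :: "nat \<Rightarrow> (nat \<Rightarrow> rat) \<Rightarrow> (nat \<Rightarrow> rat) \<Rightarrow> rat" where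
  "bracket n u e =
     (\<Sum>v | v \<in> relation_lattice n \<and> e = (\<lambda>i. u i + of_int (v i)).
        \<Prod>i=0..n. gamma_factor (u i) (v i))"

definition X_series :: "nat \<Rightarrow> nat \<Rightarrow> nat \<Rightarrow> complex \<Rightarrow> (nat \<Rightarrow> rat) \<Rightarrow> complex" where
  "X_series n i1 i2 \<xi> e =
     (let d = i2 - i1; q = (of_nat d :: rat) in
        \<xi> * of_rat (bracket n ((\<lambda>_. 0)(i1 := 1 / q, i2 := - 1 / q)) e)
      + 1 / of_nat d * (\<Sum>k=2..d. \<xi> ^ k *
          of_rat (bracket n
            ((\<lambda>_. 0)(i1 := (of_nat k - q) / q, i1 + k - 1 := 1, i2 := - of_nat k / q)) e))
      + 1 / of_nat d *
          (if i1 = 0 then 0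
           else of_rat (bracket n ((\<lambda>_. 0)(i1 - 1 := 1, i1 := - 1)) e)))"

text \<open>
  Regard a series \<open>S\<close> as a series in the \<open>a\<^sub>i\<close> with \<open>i \<noteq> i1, i2\<close>, giving the two other variables
  values. Points \<open>b1\<close> and \<open>b2\<close> of the logarithmic surface fix the values of all their fractional
  powers. For \<open>S = X_series n i1 i2 \<xi>\<close> at most one \<open>e\<close> contributes to the sum, because the
  conditions that define the lattice determine \<open>e i1\<close> and \<open>e i2\<close> from the other exponents.
\<close>

definition specialize ::
    "nat \<Rightarrow> nat \<Rightarrow> real \<times> real \<times> int \<Rightarrow> real \<times> real \<times> int \<Rightarrow>
     ((nat \<Rightarrow> rat) \<Rightarrow> complex) \<Rightarrow> (nat \<Rightarrow> rat) \<Rightarrow> complex" where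
  "specialize i1 i2 b1 b2 S w =
     (\<Sum>e | S e \<noteq> 0 \<and> e(i1 := 0, i2 := 0) = w.
        S e * lpow b1 (of_rat (e i1)) * lpow b2 (of_rat (e i2)))"

end

(*
  Let w be the branch of the root and e_j = i_j - i1. Differentiating the equation gives, for every
  integer s,
    w^(s-1) D_j w = w^(s+e_j) / d + sum_i (e_i/d - 1) c_i w^(s+e_j-1) D_i w.
  Further derivatives at 0 of this identity only see the terms in which a derivative hits c_i, so
  the derivative of order M of w at 0 in directions with sum of the e_j equal to t is, by induction,
  w(0)^(t+1)/d times the product of (t+1)/d - l over 0 < l < M. On the other side, homogeneity of the
  bracket series determines the exponents of a_i1 and a_i2 from the other ones. For each monomial only
  the index k congruent to t+1 modulo d contributes, together with the last bracket if d divides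
  t+1, and the functional equation of the factors gamma yields the same product.
*)
theory Submission
  imports Defs
begin

section \<open>Complex partial derivatives\<close>

text \<open>\<open>gamma_factor u v\<close> is the quotient Gamma(u+1) / Gamma(u+v+1). For the two
  factors that belong to \<open>a_i1\<close> and \<open>a_i2\<close>, splitting off the product over
  0 < l < M leaves an instance of the reflection formula, which is a mere sign. Since
  \<open>\<xi> ^ d = -1\<close>, this sign turns \<open>\<xi> ^ k\<close> into the power of
  \<open>\<xi>\<close> with exponent t+1, as demanded by w(0)^(t+1). The obstacle is the pole of the
  Gamma function at k = d. Write t+1 = k + d q. If k = d and q < 0, then all brackets except the
  last contribute 0, and the last one supplies exactly the missing coefficient; for k = d and q >= 0
  the last one contributes 0. If i1 = 0, all e_j are positive, so q >= 0 and nothing is missing,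
  which is why the last bracket may then be set to 0. The value of a derivative depends only on M
  and t, so every list of directions that \<open>taylor_coeff\<close> may choose gives the same
  coefficient.\<close>

definition cdifferentiable_at :: "(complex^'k::finite \<Rightarrow> complex) \<Rightarrow> complex^'k \<Rightarrow> bool" where
  "cdifferentiable_at F c \<longleftrightarrow>
     (\<exists>D. (F has_derivative D) (at c) \<and> (\<forall>s x. D (s *s x) = s * D x))"

lemma csmooth_on_iff_cdifferentiable:
  "csmooth_on U F \<longleftrightarrow> (\<forall>js. \<forall>c\<in>U. cdifferentiable_at (cpartials js F) c)"
  by (simp add: csmooth_on_def cdifferentiable_at_def)

lemma cdifferentiable_atI:
  "(F has_derivative D) (at c) \<Longrightarrow> (\<And>s x. D (s *s x) = s * D x) \<Longrightarrow> cdifferentiable_at F c"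
  by (auto simp: cdifferentiable_at_def)

lemma axis_0 [simp]: "axis j (0::complex) = 0"
  by (simp add: axis_eq_0_iff)

lemma axis_eq_scale: "axis j (t::complex) = t *s axis j 1"
  by (simp add: vec_eq_iff axis_def)

lemma bounded_linear_axis: "bounded_linear (\<lambda>t. axis j (t::complex))"
  unfolding linear_conv_bounded_linear[symmetric]
  by (rule linearI) (auto simp: vec_eq_iff axis_def)

text \<open>\<open>deriv\<close> has a value even where no derivative exists. Under
  differentiability \<open>cpartial\<close> is a genuine derivative along an axis, so the
  one-variable rules apply to it.\<close>

lemma cpartial_has_field_derivative:
  assumes "cdifferentiable_at F c"
  shows "((\<lambda>t. F (c + axis j t)) has_field_derivative cpartial j F c) (at 0)"
proof -
  obtain D where D: "(F has_derivative D) (at c)" "\<And>s x. D (s *s x) = s * D x"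
    using assms by (auto simp: cdifferentiable_at_def)
  have "((\<lambda>t::complex. c + axis j t) has_derivative (\<lambda>t. axis j t)) (at 0)"
    using has_derivative_add[OF has_derivative_const[of c]
        bounded_linear.has_derivative[OF bounded_linear_axis has_derivative_ident]] by simp
  then have "((\<lambda>t. F (c + axis j t)) has_derivative (\<lambda>t. D (axis j t))) (at 0)"
    by (rule has_derivative_compose) (simp add: D)
  \<comment> \<open>Complex linearity enters here: a map that is only real-linear need not be
    multiplication by a complex number.\<close>
  moreover have "(\<lambda>t. D (axis j t)) = (*) (D (axis j 1))"
    by (subst axis_eq_scale) (auto simp: D mult.commute)
  ultimately have "((\<lambda>t. F (c + axis j t)) has_field_derivative D (axis j 1)) (at 0)"
    by (simp add: has_field_derivative_def)
  then show ?thesis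
    by (metis DERIV_imp_deriv cpartial_def)
qed

lemma cpartial_eqI:
  "((\<lambda>t. F (c + axis j t)) has_field_derivative D) (at 0) \<Longrightarrow> cpartial j F c = D"
  by (simp add: cpartial_def DERIV_imp_deriv)

lemma cdifferentiable_at_const [simp]: "cdifferentiable_at (\<lambda>_. a) c"
  by (rule cdifferentiable_atI[where D = "\<lambda>_. 0"]) auto

lemma cdifferentiable_at_nth [simp]: "cdifferentiable_at (\<lambda>c. c $ i) c"
  by (rule cdifferentiable_atI[where D = "\<lambda>c. c $ i"])
    (auto intro: bounded_linear.has_derivative bounded_linear_vec_nth)

lemma cdifferentiable_at_add:
  assumes "cdifferentiable_at F c" "cdifferentiable_at G c"
  shows "cdifferentiable_at (\<lambda>c. F c + G c) c"
proof -
  obtain D E where "(F has_derivative D) (at c)" "\<And>s x. D (s *s x) = s * D x"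
    "(G has_derivative E) (at c)" "\<And>s x. E (s *s x) = s * E x"
    using assms by (auto simp: cdifferentiable_at_def)
  then show ?thesis
    by (intro cdifferentiable_atI[where D = "\<lambda>x. D x + E x"])
      (auto intro: has_derivative_add simp: algebra_simps)
qed

lemma cdifferentiable_at_mult:
  assumes "cdifferentiable_at F c" "cdifferentiable_at G c"
  shows "cdifferentiable_at (\<lambda>c. F c * G c) c"
proof -
  obtain D E where "(F has_derivative D) (at c)" "\<And>s x. D (s *s x) = s * D x"
    "(G has_derivative E) (at c)" "\<And>s x. E (s *s x) = s * E x"
    using assms by (auto simp: cdifferentiable_at_def)
  then show ?thesis
    by (intro cdifferentiable_atI[where D = "\<lambda>x. F c * E x + D x * G c"])
      (auto intro: has_derivative_mult, simp add: algebra_simps)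
qed

lemma cdifferentiable_at_inverse:
  assumes "cdifferentiable_at F c" "F c \<noteq> 0"
  shows "cdifferentiable_at (\<lambda>c. inverse (F c)) c"
proof -
  obtain D where "(F has_derivative D) (at c)" "\<And>s x. D (s *s x) = s * D x"
    using assms by (auto simp: cdifferentiable_at_def)
  then show ?thesis using assms(2)
    by (intro cdifferentiable_atI[where D = "\<lambda>x. - (inverse (F c) * D x * inverse (F c))"])
      (auto intro!: Deriv.has_derivative_inverse)
qed

lemma cdifferentiable_at_cong:
  assumes "open U" "c \<in> U" "\<And>c. c \<in> U \<Longrightarrow> F c = G c" "cdifferentiable_at F c"
  shows "cdifferentiable_at G c"
proof -
  obtain D where D: "(F has_derivative D) (at c)" "\<And>s x. D (s *s x) = s * D x"
    using assms(4) by (auto simp: cdifferentiable_at_def)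
  have "(G has_derivative D) (at c)"
    by (rule has_derivative_transform_within_open[OF D(1) assms(1,2,3)])
  with D(2) show ?thesis by (auto simp: cdifferentiable_at_def)
qed

lemma cdifferentiable_at_sum:
  "(\<And>i. i \<in> I \<Longrightarrow> cdifferentiable_at (F i) c) \<Longrightarrow> cdifferentiable_at (\<lambda>c. \<Sum>i\<in>I. F i c) c"
  by (induction I rule: infinite_finite_induct) (auto intro!: cdifferentiable_at_add)

lemma cpartial_const [simp]: "cpartial j (\<lambda>_. a) c = 0"
  by (rule cpartial_eqI) (auto intro!: derivative_eq_intros)

lemma axis_nth_has_field_derivative:
  "((\<lambda>t. (c + axis j t) $ i) has_field_derivative (if i = j then 1 else 0)) (at (0::complex))"
  by (auto simp: axis_def intro!: derivative_eq_intros)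

lemma cpartial_nth: "cpartial j (\<lambda>c. c $ i) c = (if i = j then 1 else 0)"
  by (rule cpartial_eqI axis_nth_has_field_derivative)+

lemma cpartial_add:
  assumes "cdifferentiable_at F c" "cdifferentiable_at G c"
  shows "cpartial j (\<lambda>c. F c + G c) c = cpartial j F c + cpartial j G c"
  by (intro cpartial_eqI DERIV_add cpartial_has_field_derivative assms)

lemma cpartial_mult:
  assumes "cdifferentiable_at F c" "cdifferentiable_at G c"
  shows "cpartial j (\<lambda>c. F c * G c) c = cpartial j F c * G c + F c * cpartial j G c"
  using DERIV_mult[OF assms[THEN cpartial_has_field_derivative], of j j]
  by (intro cpartial_eqI) (simp add: mult.commute add.commute)

lemma cpartial_sum:
  assumes "\<And>i. i \<in> I \<Longrightarrow> cdifferentiable_at (F i) c"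
  shows "cpartial j (\<lambda>c. \<Sum>i\<in>I. F i c) c = (\<Sum>i\<in>I. cpartial j (F i) c)"
  by (intro cpartial_eqI DERIV_sum cpartial_has_field_derivative assms)

lemma cpartial_inverse:
  assumes "cdifferentiable_at F c" "F c \<noteq> 0"
  shows "cpartial j (\<lambda>c. inverse (F c)) c = - (inverse (F c) * (inverse (F c) * cpartial j F c))"
  using DERIV_inverse'[OF cpartial_has_field_derivative[OF assms(1), of j]] assms(2)
  by (intro cpartial_eqI) (simp add: mult_ac)

lemma cpartial_power_int:
  assumes "cdifferentiable_at F c" "F c \<noteq> 0"
  shows "cpartial j (\<lambda>c. F c powi s) c = of_int s * (F c powi (s - 1) * cpartial j F c)"
  using DERIV_power_int[OF cpartial_has_field_derivative[OF assms(1), of j], of s] assms(2)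
  by (intro cpartial_eqI) (simp add: mult_ac)

lemma cpartial_cong:
  assumes "open U" "c \<in> U" "\<And>c. c \<in> U \<Longrightarrow> F c = G c"
  shows "cpartial j F c = cpartial j G c"
proof -
  have "isCont (\<lambda>t::complex. c + axis j t) 0"
    by (intro continuous_intros bounded_linear.continuous[OF bounded_linear_axis])
  then have "\<forall>\<^sub>F t in at 0. c + axis j t \<in> U"
    unfolding isCont_def using assms(1,2) by (simp add: topological_tendstoD)
  then have "\<forall>\<^sub>F t in nhds 0. c + axis j t \<in> U"
    using assms(2) by (simp add: eventually_nhds_conv_at)
  then show ?thesis
    unfolding cpartial_def by (intro deriv_cong_ev) (auto elim: eventually_mono simp: assms)
qed

lemma cpartials_cong:
  assumes "open U" "\<And>c. c \<in> U \<Longrightarrow> F c = G c" "c \<in> U"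
  shows "cpartials js F c = cpartials js G c"
  using assms(3) by (induction js arbitrary: c) (auto simp: assms intro: cpartial_cong[OF assms(1)])

lemma cpartials_Cons_eq:
  assumes "open U" "c \<in> U" "\<And>c. c \<in> U \<Longrightarrow> cpartials js F c = G c"
  shows "cpartials (j # js) F c = cpartial j G c"
  using cpartial_cong[OF assms] by simp

lemma cpartials_snoc: "cpartials (js @ [j]) F = cpartials js (cpartial j F)"
  by (induction js) auto

lemma csmooth_on_cpartial: "csmooth_on U F \<Longrightarrow> csmooth_on U (cpartial j F)"
  unfolding csmooth_on_iff_cdifferentiable by (metis cpartials_snoc)

lemma csmooth_onD: "csmooth_on U F \<Longrightarrow> c \<in> U \<Longrightarrow> cdifferentiable_at (cpartials js F) c"
  by (simp add: csmooth_on_iff_cdifferentiable)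

lemma csmooth_onD0: "csmooth_on U F \<Longrightarrow> c \<in> U \<Longrightarrow> cdifferentiable_at F c"
  using csmooth_onD[of U F c "[]"] by simp

section \<open>Smoothness of expressions built from smooth functions\<close>

text \<open>Every partial derivative of a member is again a member, which shows smoothness of all members.\<close>

inductive smooth_closure ::
  "(complex^'k::finite) set \<Rightarrow> (complex^'k \<Rightarrow> complex) \<Rightarrow> bool" for U where
  base: "csmooth_on U F \<Longrightarrow> smooth_closure U F"
| const: "smooth_closure U (\<lambda>_. a)"
| nth: "smooth_closure U (\<lambda>c. c $ i)"
| add: "smooth_closure U F \<Longrightarrow> smooth_closure U G \<Longrightarrow> smooth_closure U (\<lambda>c. F c + G c)"
| mult: "smooth_closure U F \<Longrightarrow> smooth_closure U G \<Longrightarrow> smooth_closure U (\<lambda>c. F c * G c)"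
| inverse: "smooth_closure U F \<Longrightarrow> (\<And>c. c \<in> U \<Longrightarrow> F c \<noteq> 0) \<Longrightarrow>
    smooth_closure U (\<lambda>c. inverse (F c))"

text \<open>The partial derivative is a member of the closure only up to its values outside
  \<open>U\<close>, where nothing is known about \<open>F\<close>; hence the witness
  \<open>G\<close>.\<close>

lemma smooth_closure_step:
  assumes "smooth_closure U F"
  shows "(\<forall>c\<in>U. cdifferentiable_at F c) \<and>
    (\<exists>G. smooth_closure U G \<and> (\<forall>c\<in>U. cpartial j F c = G c))"
  using assms
proof induction
  case (base F)
  then show ?case
    using smooth_closure.base[OF csmooth_on_cpartial[OF base]] csmooth_onD0[OF base] by blast
next
  case (const a)
  show ?case by (auto intro!: exI[of _ "\<lambda>_. 0"] smooth_closure.const)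
next
  case (nth i)
  show ?case
    by (auto simp: cpartial_nth intro!: exI[of _ "\<lambda>_. if i = j then 1 else 0"] smooth_closure.const)
next
  case (add F G)
  then obtain F' G' where "smooth_closure U F'" "\<forall>c\<in>U. cpartial j F c = F' c"
    "smooth_closure U G'" "\<forall>c\<in>U. cpartial j G c = G' c" by auto
  with add show ?case
    by (auto simp: cpartial_add cdifferentiable_at_add
        intro!: exI[of _ "\<lambda>c. F' c + G' c"] smooth_closure.add)
next
  case (mult F G)
  then obtain F' G' where "smooth_closure U F'" "\<forall>c\<in>U. cpartial j F c = F' c"
    "smooth_closure U G'" "\<forall>c\<in>U. cpartial j G c = G' c" by auto
  with mult show ?case
    by (auto simp: cpartial_mult cdifferentiable_at_mult
        intro!: exI[of _ "\<lambda>c. F' c * G c + F c * G' c"] smooth_closure.add smooth_closure.mult)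
next
  case (inverse F)
  then obtain F' where F': "smooth_closure U F'" "\<forall>c\<in>U. cpartial j F c = F' c" by auto
  have "smooth_closure U (\<lambda>c. (- 1) * (inverse (F c) * (inverse (F c) * F' c)))"
    by (intro smooth_closure.mult smooth_closure.const smooth_closure.inverse inverse F')
  with inverse F' show ?case
    by (auto simp: cpartial_inverse cdifferentiable_at_inverse
        intro!: exI[of _ "\<lambda>c. (- 1) * (inverse (F c) * (inverse (F c) * F' c))"])
qed

lemma smooth_closure_imp_csmooth_on:
  assumes "open U" "smooth_closure U F"
  shows "csmooth_on U F"
proof -
  have "\<exists>G. smooth_closure U G \<and> (\<forall>c\<in>U. cpartials js F c = G c)" for js
  proof (induction js)
    case Nil
    then show ?case using assms(2) by auto
  next
    case (Cons j js)
    then obtain G where G: "smooth_closure U G" "\<forall>c\<in>U. cpartials js F c = G c" by auto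
    obtain H where H: "smooth_closure U H" "\<forall>c\<in>U. cpartial j G c = H c"
      using smooth_closure_step[OF G(1)] by blast
    have "cpartials (j # js) F c = H c" if "c \<in> U" for c
      using cpartial_cong[OF assms(1) that, of "cpartials js F" G j] G H that by simp
    with H show ?case by auto
  qed
  then show ?thesis
    unfolding csmooth_on_iff_cdifferentiable
    by (metis assms(1) cdifferentiable_at_cong smooth_closure_step)
qed

lemma smooth_closure_power_int:
  assumes "smooth_closure U F" "\<And>c. c \<in> U \<Longrightarrow> F c \<noteq> 0"
  shows "smooth_closure U (\<lambda>c. F c powi s)"
proof -
  have pow: "smooth_closure U (\<lambda>c. G c ^ m)" if "smooth_closure U G" for G m
    by (induction m) (auto intro: smooth_closure.intros that)
  show ?thesis
    by (cases "s \<ge> 0") (auto simp: power_int_def intro!: pow assms smooth_closure.inverse)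
qed

section \<open>Iterated partial derivatives of sums, products and rescaled functions\<close>

lemma cpartials_add:
  assumes "open U" "csmooth_on U F" "csmooth_on U G" "c \<in> U"
  shows "cpartials js (\<lambda>c. F c + G c) c = cpartials js F c + cpartials js G c"
  using assms(4)
proof (induction js arbitrary: c)
  case (Cons j js)
  have "cpartials (j # js) (\<lambda>c. F c + G c) c = cpartial j (\<lambda>c. cpartials js F c + cpartials js G c) c"
    by (intro cpartials_Cons_eq[OF assms(1) Cons.prems] Cons.IH)
  then show ?case
    using Cons.prems by (simp add: cpartial_add csmooth_onD[OF assms(2)] csmooth_onD[OF assms(3)])
qed simp

lemma cpartials_cmult:
  assumes "open U" "csmooth_on U F" "c \<in> U"
  shows "cpartials js (\<lambda>c. a * F c) c = a * cpartials js F c"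
  using assms(3)
proof (induction js arbitrary: c)
  case (Cons j js)
  have "cpartials (j # js) (\<lambda>c. a * F c) c = cpartial j (\<lambda>c. a * cpartials js F c) c"
    by (intro cpartials_Cons_eq[OF assms(1) Cons.prems] Cons.IH)
  then show ?case
    using Cons.prems by (simp add: cpartial_mult csmooth_onD[OF assms(2)])
qed simp

lemma cpartials_sum:
  assumes "open U" "\<And>i. i \<in> I \<Longrightarrow> csmooth_on U (F i)" "c \<in> U"
  shows "cpartials js (\<lambda>c. \<Sum>i\<in>I. F i c) c = (\<Sum>i\<in>I. cpartials js (F i) c)"
  using assms(3)
proof (induction js arbitrary: c)
  case (Cons j js)
  have "cpartials (j # js) (\<lambda>c. \<Sum>i\<in>I. F i c) c = cpartial j (\<lambda>c. \<Sum>i\<in>I. cpartials js (F i) c) c"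
    by (intro cpartials_Cons_eq[OF assms(1) Cons.prems] Cons.IH)
  then show ?case
    using Cons.prems by (simp add: cpartial_sum csmooth_onD[OF assms(2)])
qed simp

text \<open>Leibniz rule: a coordinate has derivative 0 or 1 and no higher ones, so at most one
  entry of \<open>js\<close>, at a position \<open>k\<close>, is spent on it, and the other entries
  go to \<open>G\<close>.\<close>

lemma cpartials_nth_mult:
  assumes "open U" "csmooth_on U G" "c \<in> U"
  shows "cpartials js (\<lambda>c. c $ i * G c) c = c $ i * cpartials js G c +
    (\<Sum>k | k < length js \<and> js ! k = i. cpartials (take k js @ drop (Suc k) js) G c)"
  using assms(3)
proof (induction js arbitrary: c)
  case (Cons j js)
  let ?S = "\<lambda>c. \<Sum>k | k < length js \<and> js ! k = i. cpartials (take k js @ drop (Suc k) js) G c"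
  have "cpartials (j # js) (\<lambda>c. c $ i * G c) c = cpartial j (\<lambda>c. c $ i * cpartials js G c + ?S c) c"
    by (intro cpartials_Cons_eq[OF assms(1) Cons.prems] Cons.IH)
  also have "\<dots> = (if i = j then 1 else 0) * cpartials js G c + c $ i * cpartials (j # js) G c +
      (\<Sum>k | k < length js \<and> js ! k = i. cpartials (j # take k js @ drop (Suc k) js) G c)"
    using Cons.prems
    by (subst cpartial_add cpartial_mult cpartial_sum,
        auto intro!: cdifferentiable_at_mult cdifferentiable_at_sum csmooth_onD[OF assms(2)]
          simp: cpartial_nth cpartial_mult cpartial_sum csmooth_onD[OF assms(2)])
  also have "\<dots> = c $ i * cpartials (j # js) G c +
     (\<Sum>k | k < length (j # js) \<and> (j # js) ! k = i.
        cpartials (take k (j # js) @ drop (Suc k) (j # js)) G c)"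
  proof -
    have set_eq: "{k. k < length (j # js) \<and> (j # js) ! k = i} =
       (if i = j then {0} else {}) \<union> Suc ` {k. k < length js \<and> js ! k = i}"
      by (auto simp: image_iff nth_Cons gr0_conv_Suc split: nat.splits; metis not0_implies_Suc)
    show ?thesis
      unfolding set_eq by (subst sum.union_disjoint) (auto simp: sum.reindex)
  qed
  finally show ?case .
qed simp

lemma scale_axis: "(\<chi> l. (c + axis j t) $ l / a) = (\<chi> l. c $ l / a) + axis j (t / (a::complex))"
  by (auto simp: vec_eq_iff axis_def add_divide_distrib)

lemma cpartials_scale:
  assumes "open U" "csmooth_on U F" "a \<noteq> 0" "(\<chi> l. c $ l / a) \<in> U"
  shows "cpartials js (\<lambda>c. F (\<chi> l. c $ l / a)) c = cpartials js F (\<chi> l. c $ l / a) / a ^ length js"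
  using assms(4)
proof (induction js arbitrary: c)
  case (Cons j js)
  \<comment> \<open>Differentiating the induction hypothesis requires it on a whole neighborhood of
    \<open>c\<close>, and \<open>V\<close> is an open set of points at which it applies.\<close>
  define V where "V = (\<lambda>c::complex^'a. \<chi> l. c $ l / a) -` U"
  have "open V"
    unfolding V_def by (intro open_vimage assms continuous_intros continuous_on_vec_lambda) (use assms in auto)
  have c: "c \<in> V" using Cons.prems by (simp add: V_def)
  have "cpartials (j # js) (\<lambda>c. F (\<chi> l. c $ l / a)) c =
      cpartial j (\<lambda>c. cpartials js F (\<chi> l. c $ l / a) / a ^ length js) c"
    by (intro cpartials_Cons_eq[OF \<open>open V\<close> c] Cons.IH) (simp add: V_def)
  also have "\<dots> = cpartials (j # js) F (\<chi> l. c $ l / a) / a ^ length (j # js)"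
  proof (rule cpartial_eqI)
    let ?c = "\<chi> l. c $ l / a"
    have "((\<lambda>t. cpartials js F (?c + axis j t)) has_field_derivative cpartial j (cpartials js F) ?c) (at (0 / a))"
      using cpartial_has_field_derivative[OF csmooth_onD[OF assms(2) Cons.prems]] by simp
    moreover have "((\<lambda>t. t / a) has_field_derivative 1 / a) (at 0)"
      by (auto intro!: derivative_eq_intros simp: assms)
    ultimately have "((\<lambda>t. cpartials js F (?c + axis j (t / a))) has_field_derivative
        cpartial j (cpartials js F) ?c / a) (at 0)"
      using DERIV_chain'[of "\<lambda>t. t / a" "1 / a" 0 UNIV "\<lambda>t. cpartials js F (?c + axis j t)"]
      by simp
    from DERIV_cdivide[OF this, of "a ^ length js"]
    show "((\<lambda>t. cpartials js F (\<chi> l. (c + axis j t) $ l / a) / a ^ length js) has_field_derivative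
        cpartials (j # js) F ?c / a ^ length (j # js)) (at 0)"
      unfolding scale_axis by simp
  qed
  finally show ?case .
qed simp

section \<open>Derivatives of a root with respect to the coefficients\<close>

text \<open>Each position of the list belongs to exactly one variable. This merges the Leibniz terms
  of all products \<open>c $ i * G c\<close> into one sum over positions.\<close>

lemma sum_positions:
  fixes js :: "'k::finite list" and h :: "'k \<Rightarrow> nat \<Rightarrow> complex"
  shows "(\<Sum>i\<in>UNIV. \<Sum>k | k < length js \<and> js ! k = i. h i k) = (\<Sum>k<length js. h (js ! k) k)"
proof -
  have "(\<Sum>k<length js. h (js ! k) k) = (\<Sum>k<length js. \<Sum>i\<in>UNIV. if js ! k = i then h i k else 0)"
    by (simp add: sum.delta)
  also have "\<dots> = (\<Sum>i\<in>UNIV. \<Sum>k<length js. if js ! k = i then h i k else 0)"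
    by (rule sum.swap)
  also have "\<dots> = (\<Sum>i\<in>UNIV. \<Sum>k | k < length js \<and> js ! k = i. h i k)"
    by (rule sum.cong[OF refl]) (simp flip: sum.inter_filter)
  finally show ?thesis by simp
qed

text \<open>The gain of this form is that \<open>\<beta>\<close> and every denominator depending on
  \<open>c\<close> are gone and that the coordinates occur linearly, so that repeated
  differentiation at 0 leaves few terms.\<close>

lemma root_partial_equation:
  fixes w :: "complex^'k::finite \<Rightarrow> complex" and e :: "'k \<Rightarrow> int"
  assumes U: "open U" and w: "\<And>c. c \<in> U \<Longrightarrow> cdifferentiable_at w c"
    and w0: "\<And>c. c \<in> U \<Longrightarrow> w c \<noteq> 0"
    and eq: "\<And>c. c \<in> U \<Longrightarrow> 1 + \<beta> * w c ^ d + (\<Sum>j\<in>UNIV. c $ j * w c powi e j) = 0"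
    and "d > 0" "c \<in> U"
  shows "w c powi (s - 1) * cpartial j w c = w c powi (s + e j) / of_nat d +
    (\<Sum>i\<in>UNIV. (of_int (e i) / of_nat d - 1) *
       (c $ i * (w c powi (s + e j - 1) * cpartial i w c)))"
proof -
  \<comment> \<open>This is w times the derivative of the left-hand side of the equation with
    respect to w, after \<open>\<beta> * w^d\<close> has been eliminated by the equation. It does
    not depend on \<open>j\<close>.\<close>
  define A where "A = (\<Sum>i\<in>UNIV. (of_int (e i) - of_nat d) * (c $ i * w c powi e i)) - of_nat d"
  let ?W = "w c"
  have nz: "?W \<noteq> 0" using w0 assms by simp
  have pi: "?W powi (a + b) = ?W powi a * ?W powi b" for a b
    using nz by (simp add: power_int_add)
  have A: "cpartial j w c * A = - (?W powi (e j + 1))" for j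
  proof -
    define p where "p = cpartial j w c"
    define D where "D = \<beta> * (of_nat d * (?W powi (int d - 1) * p)) +
        (\<Sum>i\<in>UNIV. (if i = j then ?W powi e i else 0) + c $ i * (of_int (e i) * (?W powi (e i - 1) * p)))"
    note dw = cpartial_has_field_derivative[OF w[OF \<open>c \<in> U\<close>], of j, folded p_def]
    have dpow: "((\<lambda>t. w (c + axis j t) powi m) has_field_derivative of_int m * (?W powi (m - 1) * p)) (at 0)" for m
      using DERIV_power_int[OF dw, of m] nz by (simp add: mult_ac)
    have dprod: "((\<lambda>t. (c + axis j t) $ i * w (c + axis j t) powi e i) has_field_derivative
       (if i = j then ?W powi e i else 0) + c $ i * (of_int (e i) * (?W powi (e i - 1) * p))) (at 0)" for i
      using DERIV_mult[OF axis_nth_has_field_derivative[of c j i] dpow[of "e i"]]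
      by (cases "i = j") (simp_all add: add.commute mult.commute)
    have "((\<lambda>t. 1 + \<beta> * w (c + axis j t) powi int d + (\<Sum>i\<in>UNIV. (c + axis j t) $ i * w (c + axis j t) powi e i))
         has_field_derivative 0 + \<beta> * (of_int (int d) * (?W powi (int d - 1) * p)) +
        (\<Sum>i\<in>UNIV. (if i = j then ?W powi e i else 0) + c $ i * (of_int (e i) * (?W powi (e i - 1) * p)))) (at 0)"
      by (intro DERIV_add DERIV_const DERIV_cmult dpow DERIV_sum dprod)
    then have "cpartial j (\<lambda>c. 1 + \<beta> * w c ^ d + (\<Sum>j\<in>UNIV. c $ j * w c powi e j)) c = D"
      by (intro cpartial_eqI) (simp add: D_def)
    moreover have "cpartial j (\<lambda>c. 1 + \<beta> * w c ^ d + (\<Sum>j\<in>UNIV. c $ j * w c powi e j)) c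
        = cpartial j (\<lambda>_. 0) c"
      by (rule cpartial_cong[OF U \<open>c \<in> U\<close>]) (simp add: eq)
    ultimately have "D = 0" by simp
    have powm: "?W * ?W powi (m - 1) = ?W powi m" for m
      using nz by (simp add: power_int_diff)
    let ?S = "\<Sum>i\<in>UNIV. c $ i * ?W powi e i"
    let ?T = "\<Sum>i\<in>UNIV. of_int (e i) * (c $ i * ?W powi e i)"
    have "0 = ?W * D" using \<open>D = 0\<close> by simp
    also have "\<dots> = \<beta> * (of_nat d * ((?W * ?W powi (int d - 1)) * p)) + ?W * ?W powi e j +
        (\<Sum>i\<in>UNIV. c $ i * (of_int (e i) * ((?W * ?W powi (e i - 1)) * p)))"
      by (simp add: D_def distrib_left sum.distrib sum_distrib_left mult_ac)
    also have "\<dots> = (\<beta> * ?W ^ d) * (of_nat d * p) + ?W * ?W powi e j + p * ?T"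
      unfolding powm by (simp add: sum_distrib_left mult_ac)
    also have "\<beta> * ?W ^ d = - 1 - ?S"
      using eq[OF \<open>c \<in> U\<close>] by (simp add: algebra_simps add_eq_0_iff)
    finally have rel: "(1 + ?S) * (of_nat d * p) - p * ?T = ?W * ?W powi e j"
      by (simp add: algebra_simps)
    have A_eq: "A = ?T - of_nat d * ?S - of_nat d"
      by (simp add: A_def left_diff_distrib sum_subtractf sum_distrib_left)
    have "p * A = - ((1 + ?S) * (of_nat d * p) - p * ?T)"
      unfolding A_eq by (simp add: algebra_simps)
    also have "\<dots> = - (?W powi (e j + 1))"
      unfolding rel by (simp add: pi mult.commute)
    finally show ?thesis
      unfolding p_def .
  qed
  \<comment> \<open>The root is simple: a multiple of \<open>A\<close> equals a power of w(c) up to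
    sign, and w(c) is nonzero.\<close>
  have "A \<noteq> 0"
    using A[of j] nz by auto
  have "A * (w c powi (s - 1) * cpartial j w c) = - (?W powi (s - 1) * ?W powi (e j + 1))"
    using A[of j] by (metis mult.assoc mult.commute mult_minus_right)
  also have "\<dots> = - (?W powi (s + e j))"
    by (simp flip: pi)
  also have "\<dots> = A * (?W powi (s + e j) / of_nat d) +
     (\<Sum>i\<in>UNIV. (of_int (e i) / of_nat d - 1) * (c $ i * (?W powi (s + e j - 1) * (- (?W powi (e i + 1))))))"
  proof -
    have "(of_int (e i) / of_nat d - 1) * (c $ i * (?W powi (s + e j - 1) * (- (?W powi (e i + 1))))) =
        - (?W powi (s + e j)) * ((of_int (e i) / of_nat d - 1) * (c $ i * ?W powi (e i)))" for i
    proof -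
      have "?W powi (s + e j - 1) * ?W powi (e i + 1) = ?W powi (s + e j) * ?W powi e i"
        by (simp add: add.assoc flip: pi)
      moreover have "q * (a * (v * (- y))) = - (v * y) * (q * a)" for q a v y :: complex
        by (simp add: algebra_simps)
      ultimately show ?thesis
        by simp
    qed
    then have "(\<Sum>i\<in>UNIV. (of_int (e i) / of_nat d - 1) * (c $ i * (?W powi (s + e j - 1) * (- (?W powi (e i + 1))))))
        = - (?W powi (s + e j)) * (\<Sum>i\<in>UNIV. (of_int (e i) / of_nat d - 1) * (c $ i * ?W powi (e i)))"
      unfolding sum_distrib_left by (intro sum.cong refl)
    moreover have "A / of_nat d = (\<Sum>i\<in>UNIV. (of_int (e i) / of_nat d - 1) * (c $ i * ?W powi (e i))) - 1"
      using \<open>d > 0\<close> by (simp add: A_def diff_divide_distrib sum_divide_distrib left_diff_distrib)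
    moreover have "- X = A * (X / of_nat d) + S" if "S = - X * T" "A / of_nat d = T - 1" for X S T
    proof -
      have "A * (X / of_nat d) = A / of_nat d * X" by simp
      then show ?thesis unfolding that by (simp add: algebra_simps)
    qed
    ultimately show ?thesis
      by blast
  qed
  \<comment> \<open>Each \<open>- (?W powi (e i + 1))\<close> is again \<open>A\<close> times a
    partial derivative, so that \<open>A\<close> can be cancelled from the whole equation.\<close>
  also have "\<dots> = A * (?W powi (s + e j) / of_nat d +
     (\<Sum>i\<in>UNIV. (of_int (e i) / of_nat d - 1) * (c $ i * (?W powi (s + e j - 1) * cpartial i w c))))"
    unfolding A[symmetric] distrib_left sum_distrib_left
    by (intro arg_cong2[of _ _ _ _ "(+)"] sum.cong refl) (simp add: mult_ac)
  finally show ?thesis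
    using \<open>A \<noteq> 0\<close> by simp
qed

text \<open>
  Allowing all \<open>s\<close> makes the induction on the order work. It also covers \<open>s = 0\<close>, where the
  function is a logarithmic derivative and not a multiple of a derivative of a power of \<open>w\<close>.
\<close>

lemma cpartials_root_at_0:
  fixes w :: "complex^'k::finite \<Rightarrow> complex" and e :: "'k \<Rightarrow> int"
  assumes U: "open U" "0 \<in> U" and w: "csmooth_on U w"
    and w0: "\<And>c. c \<in> U \<Longrightarrow> w c \<noteq> 0"
    and eq: "\<And>c. c \<in> U \<Longrightarrow> 1 + \<beta> * w c ^ d + (\<Sum>j\<in>UNIV. c $ j * w c powi e j) = 0"
    and d: "d > 0"
    and T: "T = s + e j + sum_list (map e js)"
  shows "cpartials js (\<lambda>c. w c powi (s - 1) * cpartial j w c) 0 =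
    w 0 powi T / of_nat d * (\<Prod>l=1..length js. of_int T / of_nat d - of_nat l)"
  using T
proof (induction "length js" arbitrary: js s j T rule: less_induct)
  case less
  define K where "K = (\<lambda>s j c. w c powi (s - 1) * cpartial j w c)"
  note cl = smooth_closure.base[OF w] smooth_closure.base[OF csmooth_on_cpartial[OF w]] w0
  have cl_pow: "smooth_closure U (\<lambda>c. w c powi s)" for s
    by (rule smooth_closure_power_int) (rule cl, assumption?)+
  have cl_K: "smooth_closure U (K s j)" for s j
    unfolding K_def by (intro smooth_closure.mult cl_pow cl)
  have cl_cK: "smooth_closure U (\<lambda>c. a * (c $ i * K s j c))" for a i s j
    by (intro smooth_closure.mult smooth_closure.const smooth_closure.nth cl_K)
  have cl_cK1: "smooth_closure U (\<lambda>c. c $ i * K s j c)" for i s j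
    by (intro smooth_closure.mult smooth_closure.nth cl_K)
  have cl_sum: "smooth_closure U (\<lambda>c. \<Sum>i\<in>I. F i c)" if "\<And>i. smooth_closure U (F i)"
    for I :: "'k set" and F
    by (induction I rule: infinite_finite_induct)
      (auto intro: smooth_closure.const smooth_closure.add that)
  note smooth = smooth_closure_imp_csmooth_on[OF U(1)]
  let ?s = "s + e j"
  define x where "x = (of_int T / of_nat d :: complex)"
  \<comment> \<open>The identity for partial derivatives of a root raises the exponent from
    \<open>s\<close> to \<open>?s\<close> and expresses \<open>K s j\<close> by functions of the
    same kind.\<close>
  have "cpartials js (K s j) 0 = cpartials js (\<lambda>c. inverse (of_nat d) * w c powi ?s +
    (\<Sum>i\<in>UNIV. (of_int (e i) / of_nat d - 1) * (c $ i * K ?s i c))) 0"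
    unfolding K_def
    using root_partial_equation[OF U(1) csmooth_onD0[OF w] w0 eq d, of _ s j]
    by (intro cpartials_cong[OF U(1) _ U(2)]) (simp add: divide_inverse mult.commute)
  also have "\<dots> = inverse (of_nat d) * cpartials js (\<lambda>c. w c powi ?s) 0 +
     (\<Sum>i\<in>UNIV. (of_int (e i) / of_nat d - 1) * cpartials js (\<lambda>c. c $ i * K ?s i c) 0)"
    by (subst cpartials_add[OF U(1) smooth smooth U(2)])
      (auto intro!: smooth_closure.mult smooth_closure.const cl_pow cl_sum cl_cK
        simp: cpartials_sum[OF U(1) smooth U(2)] cl_cK cl_cK1 cl_pow cpartials_cmult[OF U(1) smooth U(2)])
  \<comment> \<open>At 0 the terms in which \<open>c $ i\<close> stays undifferentiated vanish; each
    remaining term has one derivative fewer.\<close>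
  also have "(\<Sum>i\<in>UNIV. (of_int (e i) / of_nat d - 1) * cpartials js (\<lambda>c. c $ i * K ?s i c) 0) =
     (\<Sum>k<length js. (of_int (e (js ! k)) / of_nat d - 1) *
        cpartials (take k js @ drop (Suc k) js) (K ?s (js ! k)) 0)"
    by (subst sum_positions[symmetric]) (simp add: cpartials_nth_mult[OF U(1) smooth U(2)] cl_K sum_distrib_left)
  finally have rec: "cpartials js (K s j) 0 = inverse (of_nat d) * cpartials js (\<lambda>c. w c powi ?s) 0 +
     (\<Sum>k<length js. (of_int (e (js ! k)) / of_nat d - 1) *
        cpartials (take k js @ drop (Suc k) js) (K ?s (js ! k)) 0)" .
  show ?case
  proof (cases js rule: rev_cases)
    case Nil
    with rec less.prems show ?thesis
      by (simp add: K_def divide_inverse mult.commute)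
  next
    case (snoc js' i0)
    define P where "P = w 0 powi T / of_nat d * (\<Prod>l=1..length js'. x - of_nat l)"
    \<comment> \<open>The last entry of the list is the innermost derivative; applied to a power of
      w it produces \<open>K ?s i0\<close>.\<close>
    have "cpartials js (\<lambda>c. w c powi ?s) 0 = cpartials js' (\<lambda>c. of_int ?s * K ?s i0 c) 0"
      unfolding snoc cpartials_snoc K_def using U
      by (intro cpartials_cong[OF U(1)] cpartial_power_int) (auto intro: csmooth_onD0[OF w] dest: w0)
    also have "\<dots> = of_int ?s * cpartials js' (K ?s i0) 0"
      by (simp add: cpartials_cmult[OF U(1) smooth U(2)] cl_K)
    also have "cpartials js' (K ?s i0) 0 = P"
      unfolding K_def P_def x_def
      by (rule less.hyps) (use snoc less.prems in auto)
    finally have 1: "cpartials js (\<lambda>c. w c powi ?s) 0 = of_int ?s * P" .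
    \<comment> \<open>Moving entry \<open>k\<close> out of the list and into the second index of
      \<open>K\<close> shortens the list but keeps the total \<open>T\<close>. Hence all these terms
      have the same value \<open>P\<close>.\<close>
    have 2: "cpartials (take k js @ drop (Suc k) js) (K ?s (js ! k)) 0 = P" if "k < length js" for k
    proof -
      have len: "length (take k js @ drop (Suc k) js) = length js'"
        using that snoc by simp
      have "sum_list (map e js) = sum_list (map e (take k js @ js ! k # drop (Suc k) js))"
        using arg_cong[OF id_take_nth_drop[OF that], of "\<lambda>js. sum_list (map e js)"] .
      then have "T = ?s + e (js ! k) + sum_list (map e (take k js @ drop (Suc k) js))"
        using less.prems by simp
      then show ?thesis
        unfolding K_def P_def x_def len[symmetric]
        by (intro less.hyps) (use that in auto)
    qed
    have sums: "(\<Sum>k<length js. of_int (e (js ! k))) = (of_int (sum_list (map e js)) :: complex)"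
      by (simp add: sum_list_sum_nth atLeast0LessThan)
    have "(\<Sum>k<length js. (of_int (e (js ! k)) / of_nat d - 1) *
        cpartials (take k js @ drop (Suc k) js) (K ?s (js ! k)) 0) =
        (\<Sum>k<length js. of_int (e (js ! k)) / of_nat d - 1) * P"
      unfolding sum_distrib_right by (intro sum.cong refl) (simp only: 2 lessThan_iff)
    also have "(\<Sum>k<length js. of_int (e (js ! k)) / of_nat d - 1) =
        of_int (sum_list (map e js)) / of_nat d - (of_nat (length js) :: complex)"
      by (simp add: sum_subtractf sums flip: sum_divide_distrib)
    finally have "cpartials js (K s j) 0 = inverse (of_nat d) * (of_int ?s * P) +
        (of_int (sum_list (map e js)) / of_nat d - of_nat (length js)) * P"
      unfolding rec 1 by simp
    \<comment> \<open>The coefficients of \<open>P\<close> add up because \<open>?s\<close> and the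
      sum over \<open>js\<close> together make \<open>T\<close>; the result is the next factor of
      the product.\<close>
    also have "\<dots> = P * (x - of_nat (length js))"
      unfolding x_def less.prems by (simp add: divide_inverse algebra_simps)
    finally show ?thesis
      by (simp add: K_def P_def x_def snoc)
  qed
qed

section \<open>The gamma factors\<close>

lemma falling_factorial_Suc:
  "falling_factorial x (Suc k) = falling_factorial x k * (x - of_nat k)"
  by (simp add: falling_factorial_def)

lemma gamma_factor_0 [simp]: "gamma_factor u 0 = 1"
  by (simp add: gamma_factor_def)

text \<open>
  The excluded case is the jump of \<open>gamma_factor u\<close> from nonzero values to \<open>0\<close> at \<open>v = - u\<close> for
  a negative integer \<open>u\<close>.
\<close>

lemma gamma_factor_rec:
  assumes "u + of_int v + 1 \<noteq> 0 \<or> u \<ge> 0 \<or> v < 0"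
  shows "gamma_factor u v = gamma_factor u (v + 1) * (u + of_int v + 1)"
proof (cases "v < 0")
  case True
  define k where "k = nat (- v - 1)"
  have v: "v = - int (Suc k)" using True by (simp add: k_def)
  have "gamma_factor u v = falling_factorial u (Suc k)"
    by (simp add: gamma_factor_def v nat_add_distrib)
  moreover have "gamma_factor u (v + 1) = falling_factorial u k"
    by (cases "k = 0") (simp_all add: gamma_factor_def v falling_factorial_def)
  ultimately show ?thesis
    by (simp add: falling_factorial_Suc v)
next
  case False
  then obtain k where v: "v = int k" by (metis nonneg_int_cases not_less)
  have nz: "u + of_nat k + 1 \<noteq> 0" using assms v by auto
  show ?thesis
  proof (cases "u \<in> \<int> \<and> 0 > u \<and> u \<ge> - of_nat k")
    case True
    then show ?thesis by (auto simp: gamma_factor_def v)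
  next
    case nonpole: False
    \<comment> \<open>From \<open>k\<close> to \<open>Suc k\<close> the only new value of
      \<open>u\<close> in the exceptional range is \<open>- of_nat (Suc k)\<close>, which
      \<open>nz\<close> excludes.\<close>
    have "\<not> (u \<in> \<int> \<and> 0 > u \<and> u \<ge> - of_nat (Suc k))"
    proof (intro notI)
      assume asm: "u \<in> \<int> \<and> 0 > u \<and> u \<ge> - of_nat (Suc k)"
      then obtain z where z: "u = of_int z" by (auto elim: Ints_cases)
      have "of_int z \<ge> (of_int (- int (Suc k)) :: rat)" "\<not> of_int z \<ge> (of_int (- int k) :: rat)"
        using asm nonpole z by auto
      then have "z \<ge> - int (Suc k)" "\<not> z \<ge> - int k"
        unfolding of_int_le_iff by auto
      then have "z = - int k - 1" by linarith
      with z nz show False by simp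
    qed
    then have "gamma_factor u (v + 1) = 1 / (\<Prod>i=1..Suc k. u + of_nat i)"
      by (auto simp: gamma_factor_def v nat_add_distrib add.commute)
    moreover have "gamma_factor u v = 1 / (\<Prod>i=1..k. u + of_nat i)"
      using nonpole by (auto simp: gamma_factor_def v)
    ultimately show ?thesis
      using nz by (simp add: v) (simp add: add_ac)
  qed
qed

text \<open>In terms of Gamma quotients this is Gamma(u+1) = u Gamma(u). For positive
  \<open>u\<close> neither \<open>u\<close> nor \<open>u - 1\<close> is a negative integer, so the
  exceptional case stays away.\<close>

lemma gamma_factor_shift:
  assumes "u > 0"
  shows "gamma_factor u v = u * gamma_factor (u - 1) (v + 1)"
proof (induction v rule: int_induct[where k = 0])
  case base
  show ?case using gamma_factor_rec[of "u - 1" 0] assms by (simp add: mult.commute)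
next
  case (step1 i)
  have pos: "u + of_int i + 1 > 0"
    using assms step1.hyps by (simp add: add_pos_nonneg)
  have "gamma_factor u (i + 1) * (u + of_int i + 1) =
      u * gamma_factor (u - 1) (i + 1 + 1) * (u + of_int i + 1)"
    using step1 gamma_factor_rec[of u i] gamma_factor_rec[of "u - 1" "i + 1"] pos by (simp add: mult_ac)
  then show ?case using pos by simp
next
  case (step2 i)
  have "gamma_factor u (i - 1) = gamma_factor u i * (u + of_int i)"
    using gamma_factor_rec[of u "i - 1"] assms by simp
  moreover have "gamma_factor (u - 1) i = gamma_factor (u - 1) (i + 1) * (u + of_int i)"
    using gamma_factor_rec[of "u - 1" i]  step2.hyps
    using assms by (cases "u + of_int i = 0"; cases "i = 0") auto
  ultimately show ?case using step2 by simp
qed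

lemma gamma_factor_zero_neg: "v < 0 \<Longrightarrow> gamma_factor 0 v = 0"
  by (auto simp: gamma_factor_def falling_factorial_def intro!: bexI[of _ 1])

lemma gamma_factor_zero_nat: "gamma_factor 0 (int m) = 1 / fact m"
proof (induction m)
  case (Suc m)
  have "gamma_factor 0 (int m) = gamma_factor 0 (int (Suc m)) * (1 + of_nat m)"
    using gamma_factor_rec[of 0 "int m"] by (simp add: add.commute)
  then have "gamma_factor 0 (int (Suc m)) * (1 + of_nat m) = 1 / fact m" using Suc by simp
  moreover have "(1 + of_nat m :: rat) \<noteq> 0" by (metis of_nat_Suc of_nat_neq_0)
  ultimately show ?case by (simp add: eq_divide_eq mult_ac)
qed simp

text \<open>A variable that is displayed with exponent 1 and one that is not displayed have the same
  factor as a function of the final exponent. So the middle and last brackets carry the same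
  factorials as a Taylor series, and negative exponents drop out.\<close>

lemma gamma_factor_01:
  assumes "u \<in> {0, 1}"
  shows "gamma_factor u v = (if u + of_int v < 0 then 0 else 1 / fact (nat \<lfloor>u + of_int v\<rfloor>))"
proof -
  have 0: "gamma_factor 0 v = (if v < 0 then 0 else 1 / fact (nat v))" for v
    using gamma_factor_zero_nat[of "nat v"] gamma_factor_zero_neg[of v] by auto
  have "(1 + of_int v < (0::rat)) = (1 + v < 0)"
    by (metis of_int_1 of_int_add of_int_less_0_iff)
  moreover have "\<lfloor>1 + of_int v :: rat\<rfloor> = 1 + v"
    by simp
  ultimately show ?thesis
    using assms 0[of v] 0[of "1 + v"] gamma_factor_shift[of 1 v] by (auto simp: add.commute)
qed

text \<open>Euler's reflection formula: the product is sin(pi (u+q)) / sin(pi u) for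
  \<open>u < 1\<close>. At \<open>u = 1\<close> the recursion breaks between \<open>q = 0\<close>
  and \<open>q = -1\<close>, and the value 0 takes over.\<close>

lemma gamma_factor_reflection:
  assumes "0 < u" "u \<le> 1"
  shows "gamma_factor (u - 1) q * gamma_factor (- u) (- q) = (if q \<ge> 0 \<or> u < 1 then (- 1) powi q else 0)"
proof -
  let ?F = "\<lambda>q. gamma_factor (u - 1) q * gamma_factor (- u) (- q)"
  have step: "?F (q + 1) = - ?F q" if nz: "u + of_int q \<noteq> 0" for q
  proof -
    have 1: "gamma_factor (u - 1) q = gamma_factor (u - 1) (q + 1) * (u + of_int q)"
      using gamma_factor_rec[of "u - 1" q] nz by simp
    have 2: "gamma_factor (- u) (- (q + 1)) = gamma_factor (- u) (- q) * - (u + of_int q)"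
      using gamma_factor_rec[of "- u" "- q - 1"] nz by (simp add: add_eq_0_iff)
    show ?thesis
      unfolding 1 2 by (simp add: mult_ac del: minus_add_distrib)
  qed
  show ?thesis
  proof (induction q rule: int_induct[where k = 0])
    case base
    show ?case by simp
  next
    case (step1 i)
    have "u + of_int i > 0" using assms step1.hyps by (simp add: add_pos_nonneg)
    then show ?case using step[of i] step1 by (simp add: power_int_add)
  next
    case (step2 i)
    show ?case
    proof (cases "u < 1")
      case True
      have "u + of_int (i - 1) < 1 + of_int (i - 1)" using True by simp
      also have "\<dots> = of_int i" by simp
      also have "\<dots> \<le> 0" using step2.hyps by simp
      finally have "?F i = - ?F (i - 1)" using step[of "i - 1"] by simp
      then show ?thesis using step2 True by (simp add: power_int_diff)
    next
      case False
      then have "u = 1" using assms by simp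
      then show ?thesis using step2.hyps by (simp add: gamma_factor_zero_neg)
    qed
  qed
qed

text \<open>Iterated recursion; it is the source of the product over 0 < l < M on the side of the
  brackets.\<close>

lemma gamma_factor_diff_nat:
  assumes "u \<ge> 0 \<or> (\<forall>l\<in>{1..N}. u + of_int v + 1 - of_nat l \<noteq> 0)"
  shows "gamma_factor u (v - int N) = gamma_factor u v * (\<Prod>l=1..N. u + of_int v + 1 - of_nat l)"
  using assms
proof (induction N)
  case (Suc N)
  have "gamma_factor u (v - int (Suc N)) =
      gamma_factor u (v - int N) * (u + of_int v + 1 - of_nat (Suc N))"
  proof -
    have "v - int (Suc N) + 1 = v - int N"
      "u + of_int (v - int (Suc N)) + 1 = u + of_int v + 1 - of_nat (Suc N)" by simp_all
    moreover have "u \<ge> 0 \<or> u + of_int v + 1 - of_nat (Suc N) \<noteq> 0"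
      using Suc.prems by (force simp del: of_nat_Suc)
    ultimately show ?thesis
      using gamma_factor_rec[of u "v - int (Suc N)"] by argo
  qed
  moreover have "gamma_factor u (v - int N) = gamma_factor u v * (\<Prod>l=1..N. u + of_int v + 1 - of_nat l)"
    using Suc by auto
  ultimately show ?case by (simp add: mult.assoc)
qed simp

section \<open>Coefficients of the bracket series\<close>

locale root_series =
  fixes n i1 i2 d :: nat
  assumes i12: "i1 < i2" "i2 \<le> n" and d_eq: "d = i2 - i1"
begin

definition I where "I = {0..n} - {i1, i2}"

definition multi_index :: "(nat \<Rightarrow> nat) \<Rightarrow> bool" where
  "multi_index m \<longleftrightarrow> (\<forall>i. i \<notin> I \<longrightarrow> m i = 0)"

definition total :: "(nat \<Rightarrow> nat) \<Rightarrow> nat" where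
  "total m = (\<Sum>i\<in>I. m i)"

definition weight :: "(nat \<Rightarrow> nat) \<Rightarrow> int" where
  "weight m = (\<Sum>i\<in>I. int (m i) * (int i - int i1))"

text \<open>The number (t+1)/d for t = \<open>weight m\<close>: w(0)^(t+1) contains
  \<open>a_i1\<close> with this exponent and \<open>a_i2\<close> with its negative. Dividing the
  variables by \<open>a_i1\<close> lowers the former by \<open>total m\<close>.\<close>

definition slope :: "(nat \<Rightarrow> nat) \<Rightarrow> rat" where
  "slope m = (of_int (weight m) + 1) / of_nat d"

definition exponent :: "(nat \<Rightarrow> nat) \<Rightarrow> nat \<Rightarrow> rat" where
  "exponent m i = (if i = i1 then slope m - of_nat (total m) else if i = i2 then - slope m
     else of_nat (m i))"

text \<open>The common properties of the start exponents of all brackets. The two sums are invariant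
  under the lattice; 0 and -1 are their values at the root
  \<open>a_i1^(1/d) a_i2^(-1/d)\<close>.\<close>

definition admissible :: "(nat \<Rightarrow> rat) \<Rightarrow> bool" where
  "admissible u \<longleftrightarrow> (\<forall>i>n. u i = 0) \<and> (\<forall>i\<in>I. u i \<in> {0, 1}) \<and>
     (\<Sum>i=0..n. u i) = 0 \<and> (\<Sum>i=0..n. of_nat i * u i) = - 1"

lemma d_pos: "d > 0"
  using i12 d_eq by simp

lemma finite_I [simp]: "finite I"
  by (simp add: I_def)

lemma i2_eq: "i2 = i1 + d"
  using i12 d_eq by simp

lemma I_cases: "i \<in> I \<or> i = i1 \<or> i = i2 \<or> i > n"
  by (auto simp: I_def)

lemma sum_split: "(\<Sum>i=0..n. f i) = f i1 + f i2 + (\<Sum>i\<in>I. f i)"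
  for f :: "nat \<Rightarrow> 'a::comm_monoid_add"
proof -
  have "{0..n} = insert i1 (insert i2 I)" "i1 \<noteq> i2" "i1 \<notin> I" "i2 \<notin> I"
    using i12 by (auto simp: I_def)
  then show ?thesis by (simp add: add.assoc)
qed

lemma prod_split: "(\<Prod>i=0..n. f i) = f i1 * f i2 * (\<Prod>i\<in>I. f i)"
  for f :: "nat \<Rightarrow> 'a::comm_monoid_mult"
proof -
  have "{0..n} = insert i1 (insert i2 I)" "i1 \<noteq> i2" "i1 \<notin> I" "i2 \<notin> I"
    using i12 by (auto simp: I_def)
  then show ?thesis by (simp add: mult.assoc)
qed

lemma exponent_I: "i \<in> I \<Longrightarrow> exponent m i = of_nat (m i)"
  by (auto simp: exponent_def I_def)

lemma weight_rat: "of_int (weight m) = (\<Sum>i\<in>I. of_nat i * of_nat (m i) :: rat) - of_nat i1 * of_nat (total m)"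
  by (simp add: weight_def total_def sum_distrib_left algebra_simps sum_subtractf)

lemma slope_d: "of_nat d * slope m = of_int (weight m) + 1"
  using d_pos by (simp add: slope_def)

lemma exponent_sums:
  "(\<Sum>i=0..n. exponent m i) = 0" "(\<Sum>i=0..n. of_nat i * exponent m i) = - 1"
proof -
  have "i1 \<noteq> i2" using i12 by simp
  then show "(\<Sum>i=0..n. exponent m i) = 0"
    by (simp add: sum_split exponent_I) (simp add: exponent_def total_def)
  have "(\<Sum>i=0..n. of_nat i * exponent m i) =
      of_nat i1 * (slope m - of_nat (total m)) - of_nat i2 * slope m + (\<Sum>i\<in>I. of_nat i * of_nat (m i))"
    using \<open>i1 \<noteq> i2\<close> by (simp add: sum_split exponent_I) (simp add: exponent_def)
  also have "\<dots> = - (of_nat d * slope m) + of_int (weight m)"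
    by (simp add: weight_rat i2_eq[THEN arg_cong, of of_nat] algebra_simps)
  finally show "(\<Sum>i=0..n. of_nat i * exponent m i) = - 1"
    by (simp add: slope_d)
qed

text \<open>The two sums are linear equations for \<open>e i1\<close> and \<open>e i2\<close> with
  determinant i2 - i1 = \<open>d\<close>, which is positive.\<close>

lemma exponent_unique:
  assumes "\<And>i. i \<noteq> i1 \<Longrightarrow> i \<noteq> i2 \<Longrightarrow> e i = of_nat (m i)"
    and "(\<Sum>i=0..n. e i) = 0" "(\<Sum>i=0..n. of_nat i * e i) = - 1"
  shows "e = exponent m"
proof -
  have eI: "e i = of_nat (m i)" if "i \<in> I" for i
    using assms(1) that by (auto simp: I_def)
  have 1: "e i1 + e i2 = - of_nat (total m)"
    using assms(2) by (simp add: sum_split eI total_def add_eq_0_iff2)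
  have "- 1 = of_nat i1 * (e i1 + e i2) + of_nat d * e i2 + (\<Sum>i\<in>I. of_nat i * of_nat (m i))"
    using assms(3) by (simp add: sum_split eI i2_eq algebra_simps)
  then have "of_nat d * e i2 = - (of_nat d * slope m)"
    unfolding 1 slope_d weight_rat by simp
  then have "of_nat d * (e i2 + slope m) = 0"
    by (simp add: algebra_simps)
  then have 2: "e i2 = - slope m"
    using d_pos by (simp add: add_eq_0_iff2)
  then have "e i1 = slope m - of_nat (total m)"
    using 1 by simp
  with 2 assms(1) show ?thesis
    by (auto simp: exponent_def)
qed

text \<open>A negative exponent of a variable in \<open>I\<close> makes its gamma factor 0, so only
  powers with natural exponents survive there. The invariant sums then fix the other two
  exponents.\<close>

lemma bracket_nonzero:
  assumes "admissible u" "bracket n u e \<noteq> 0"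
  shows "\<exists>m. multi_index m \<and> e = exponent m"
proof -
  obtain v where v: "v \<in> relation_lattice n" "e = (\<lambda>i. u i + of_int (v i))"
    and nz: "(\<Prod>i=0..n. gamma_factor (u i) (v i)) \<noteq> 0"
    using assms(2) unfolding bracket_def
    by (metis (mono_tags, lifting) mem_Collect_eq sum.not_neutral_contains_not_neutral)
  define m where "m = (\<lambda>i. if i \<in> I then nat \<lfloor>e i\<rfloor> else 0)"
  have eI: "e i = of_nat (m i)" if "i \<in> I" for i
  proof -
    have u: "u i \<in> {0, 1}" using assms(1) that by (auto simp: admissible_def)
    have "gamma_factor (u i) (v i) \<noteq> 0"
      using nz that by (auto simp: prod_split)
    then have pos: "e i \<ge> 0"
      using u v(2) by (auto simp: gamma_factor_01 split: if_splits)
    moreover have "e i \<in> \<int>" using u v(2) by auto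
    ultimately show ?thesis using that
      by (auto simp: m_def elim!: Ints_cases)
  qed
  have e_out: "e i = 0" if "i > n" for i
    using that v assms(1) by (auto simp: relation_lattice_def admissible_def)
  have "e = exponent m"
  proof (rule exponent_unique)
    show "e i = of_nat (m i)" if "i \<noteq> i1" "i \<noteq> i2" for i
      using I_cases[of i] that eI e_out by (auto simp: m_def I_def)
    have s: "(\<Sum>i=0..n. int i * v i) = 0" "(\<Sum>i=0..n. v i) = 0"
      using v(1) by (auto simp: relation_lattice_def)
    have "(\<Sum>i=0..n. of_int (v i)) = (0 :: rat)"
      using arg_cong[OF s(2), of "of_int :: int \<Rightarrow> rat"] by simp
    then show "(\<Sum>i=0..n. e i) = 0"
      using assms(1) by (simp add: v(2) sum.distrib admissible_def)
    have "(\<Sum>i=0..n. of_nat i * of_int (v i)) = (0 :: rat)"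
      using arg_cong[OF s(1), of "of_int :: int \<Rightarrow> rat"] by simp
    then show "(\<Sum>i=0..n. of_nat i * e i) = - 1"
      using assms(1) by (simp add: v(2) sum.distrib admissible_def distrib_left)
  qed
  moreover have "multi_index m" by (simp add: multi_index_def m_def)
  ultimately show ?thesis by blast
qed

text \<open>Within a bracket the exponent of \<open>a_i2\<close> is fixed modulo 1. This alone
  separates the brackets with different \<open>k\<close>.\<close>

lemma bracket_eq_0:
  assumes "- slope m - u i2 \<notin> \<int>"
  shows "bracket n u (exponent m) = 0"
proof -
  have "exponent m \<noteq> (\<lambda>i. u i + of_int (v i))" for v
  proof
    assume "exponent m = (\<lambda>i. u i + of_int (v i))"
    from fun_cong[OF this, of i2] have "- slope m - u i2 = of_int (v i2)"
      using i12 by (simp add: exponent_def)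
    with assms show False by simp
  qed
  then show ?thesis by (simp add: bracket_def)
qed

text \<open>The exponent vector determines the lattice vector, so the sum has one term, and its
  factors over \<open>I\<close> are inverse factorials.\<close>

lemma bracket_exponent:
  assumes u: "admissible u" and m: "multi_index m"
    and p1: "slope m - of_nat (total m) = u i1 + of_int p1" and p2: "- slope m = u i2 + of_int p2"
  shows "bracket n u (exponent m) =
    gamma_factor (u i1) p1 * gamma_factor (u i2) p2 / (\<Prod>i\<in>I. fact (m i))"
proof -
  have ne: "i1 \<noteq> i2" using i12 by simp
  define v where "v = (\<lambda>i. \<lfloor>exponent m i - u i\<rfloor>)"
  have "exponent m i - u i \<in> \<int>" for i
  proof -
    consider "i \<in> I" | "i = i1" | "i = i2" | "i > n" using I_cases by blast
    then show ?thesis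
    proof cases
      case 1
      then have "u i \<in> \<int>" using u by (auto simp: admissible_def)
      then show ?thesis using 1 by (simp add: exponent_I)
    next
      case 4
      then have "u i = 0" "i \<noteq> i1" "i \<noteq> i2" using u i12 by (auto simp: admissible_def)
      then show ?thesis by (simp add: exponent_def)
    qed (use ne in \<open>simp_all add: exponent_def p1 p2\<close>)
  qed
  then have v: "of_int (v i) = exponent m i - u i" for i
    by (simp add: v_def)
  have v12: "v i1 = p1" "v i2 = p2"
    using v[of i1] v[of i2] ne by (simp_all add: exponent_def p1 p2)
  have "v \<in> relation_lattice n"
  proof -
    have "v i = 0" if "i > n" for i
    proof -
      have "(of_int (v i) :: rat) = 0"
        using that u m i12 by (auto simp: v admissible_def exponent_def multi_index_def I_def)
      then show ?thesis by simp
    qed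
    moreover have "(of_int (\<Sum>i=0..n. v i) :: rat) = 0"
      using u by (simp add: v sum_subtractf exponent_sums admissible_def)
    then have "(\<Sum>i=0..n. v i) = 0"
      by (simp only: of_int_eq_0_iff)
    moreover have "(of_int (\<Sum>i=0..n. int i * v i) :: rat) = 0"
      using u by (simp add: v sum_subtractf exponent_sums admissible_def right_diff_distrib)
    then have "(\<Sum>i=0..n. int i * v i) = 0"
      by (simp only: of_int_eq_0_iff)
    ultimately show ?thesis by (simp add: relation_lattice_def)
  qed
  moreover have "v' = v" if "exponent m = (\<lambda>i. u i + of_int (v' i))" for v'
    using fun_cong[OF that] by (auto simp: v_def)
  moreover have "exponent m = (\<lambda>i. u i + of_int (v i))"
    by (simp add: v)
  ultimately have "{v. v \<in> relation_lattice n \<and> exponent m = (\<lambda>i. u i + of_int (v i))} = {v}"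
    by blast
  then have "bracket n u (exponent m) = (\<Prod>i=0..n. gamma_factor (u i) (v i))"
    by (simp add: bracket_def)
  also have "\<dots> = gamma_factor (u i1) p1 * gamma_factor (u i2) p2 * (\<Prod>i\<in>I. 1 / fact (m i))"
  proof -
    have "gamma_factor (u i) (v i) = 1 / fact (m i)" if "i \<in> I" for i
    proof -
      have "u i \<in> {0, 1}" using u that by (auto simp: admissible_def)
      moreover have "u i + of_int (v i) = of_nat (m i)"
        using that by (simp add: v exponent_I)
      ultimately show ?thesis by (simp add: gamma_factor_01)
    qed
    then show ?thesis by (simp add: prod_split v12)
  qed
  finally show ?thesis by (simp add: prod_dividef)
qed

section \<open>Start exponents of the three kinds of brackets\<close>

lemma admissible_first:
  "admissible ((\<lambda>_. 0)(i1 := 1 / of_nat d, i2 := - 1 / of_nat d))"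
proof -
  have "i1 \<noteq> i2" "\<And>i. i \<in> I \<Longrightarrow> i \<noteq> i1 \<and> i \<noteq> i2" "i1 \<le> n" using i12 by (auto simp: I_def)
  moreover have "of_nat i2 = (of_nat i1 + of_nat d :: rat)" by (simp add: i2_eq[THEN arg_cong])
  ultimately show ?thesis
    using d_pos i12 by (auto simp: admissible_def sum_split field_simps)
qed

lemma admissible_middle:
  assumes "k \<in> {2..d}"
  shows "admissible ((\<lambda>_. 0)(i1 := (of_nat k - of_nat d) / of_nat d, i1 + k - 1 := 1,
      i2 := - of_nat k / of_nat d))" (is "admissible ?u")
proof -
  have ne: "i1 \<noteq> i2" "i1 + k - 1 \<in> I" "i1 + k - 1 \<noteq> i1" "i1 + k - 1 \<noteq> i2"
    using assms i12 d_eq by (auto simp: I_def)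
  have uI: "?u i = (if i = i1 + k - 1 then 1 else 0)" if "i \<in> I" for i
    using that by (auto simp: I_def)
  have u12: "?u i1 = of_nat k / of_nat d - 1" "?u i2 = - of_nat k / of_nat d"
    using ne d_pos by (auto simp: diff_divide_distrib)
  have out: "?u i = 0" if "i > n" for i
    using that ne i12 by (auto simp: I_def)
  have "(\<Sum>i\<in>I. of_nat i * ?u i) = (\<Sum>i\<in>I. if i = i1 + k - 1 then of_nat i else 0)"
    by (intro sum.cong refl) (subst uI, auto)
  also have "\<dots> = of_nat (i1 + k - 1)" using ne by simp
  also have "\<dots> = of_nat i1 + of_nat k - 1"
    using assms by (simp add: of_nat_diff)
  finally have s: "(\<Sum>i\<in>I. of_nat i * ?u i) = of_nat i1 + of_nat k - 1" .
  have "(\<Sum>i\<in>I. ?u i) = (\<Sum>i\<in>I. if i = i1 + k - 1 then 1 else 0)"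
    by (intro sum.cong refl uI)
  also have "\<dots> = 1"
    using ne(2) by simp
  finally have "(\<Sum>i\<in>I. ?u i) = 1" .
  then have "(\<Sum>i=0..n. ?u i) = 0"
    unfolding sum_split u12 by simp
  moreover have "(\<Sum>i=0..n. of_nat i * ?u i) = - 1"
    unfolding sum_split u12 s using d_pos by (simp add: i2_eq field_simps)
  ultimately show ?thesis
    using uI out by (simp add: admissible_def del: fun_upd_apply)
qed

lemma admissible_last:
  assumes "i1 > 0"
  shows "admissible ((\<lambda>_. 0)(i1 - 1 := 1, i1 := - 1))" (is "admissible ?u")
proof -
  have ne: "i1 \<noteq> i2" "i1 - 1 \<in> I" "i1 - 1 \<noteq> i1" "i1 - 1 \<noteq> i2"
    using assms i12 by (auto simp: I_def)
  have uI: "?u i = (if i = i1 - 1 then 1 else 0)" if "i \<in> I" for i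
    using that by (auto simp: I_def)
  have u12: "?u i1 = - 1" "?u i2 = 0"
    using ne by auto
  have out: "?u i = 0" if "i > n" for i
    using that ne i12 by (auto simp: I_def)
  have "(\<Sum>i\<in>I. of_nat i * ?u i) = (\<Sum>i\<in>I. if i = i1 - 1 then of_nat i else 0)"
    by (intro sum.cong refl) (subst uI, auto)
  also have "\<dots> = of_nat (i1 - 1)" using ne by simp
  also have "\<dots> = of_nat i1 - 1"
    using assms by (simp add: of_nat_diff)
  finally have s: "(\<Sum>i\<in>I. of_nat i * ?u i) = of_nat i1 - 1" .
  have "(\<Sum>i\<in>I. ?u i) = (\<Sum>i\<in>I. if i = i1 - 1 then 1 else 0)"
    by (intro sum.cong refl uI)
  also have "\<dots> = 1"
    using ne(2) by simp
  finally have "(\<Sum>i\<in>I. ?u i) = 1" .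
  then have "(\<Sum>i=0..n. ?u i) = 0"
    unfolding sum_split u12 by simp
  moreover have "(\<Sum>i=0..n. of_nat i * ?u i) = - 1"
    unfolding sum_split u12 s by simp
  ultimately show ?thesis
    using uI out by (simp add: admissible_def del: fun_upd_apply)
qed

section \<open>Division of the weight by d and the coefficients of single brackets\<close>

definition residue :: "(nat \<Rightarrow> nat) \<Rightarrow> nat" where
  "residue m = nat (weight m mod int d) + 1"

text \<open>With \<open>residue\<close> this is division of \<open>weight m + 1\<close> by
  \<open>d\<close> with remainders in \<open>{1..d}\<close> instead of 0 to d-1, matching the
  indices k of the brackets.\<close>

definition quotient :: "(nat \<Rightarrow> nat) \<Rightarrow> int" where
  "quotient m = weight m div int d"

lemma residue_range: "residue m \<in> {1..d}"
proof -
  have "0 \<le> weight m mod int d" "weight m mod int d < int d" using d_pos by auto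
  then show ?thesis by (auto simp: residue_def)
qed

lemma weight_eq: "weight m + 1 = int (residue m) + int d * quotient m"
  using d_pos by (simp add: residue_def quotient_def)

lemma slope_eq: "slope m = of_nat (residue m) / of_nat d + of_int (quotient m)"
proof -
  have "of_int (weight m + 1) = (of_nat (residue m) + of_nat d * of_int (quotient m) :: rat)"
    unfolding weight_eq by simp
  then show ?thesis
    using d_pos by (simp add: slope_def add_divide_distrib)
qed

lemma slope_diff_Ints_iff:
  assumes "k \<in> {1..d}"
  shows "- slope m + of_nat k / of_nat d \<in> \<int> \<longleftrightarrow> k = residue m"
proof
  assume "- slope m + of_nat k / of_nat d \<in> \<int>"
  then obtain z where z: "- slope m + of_nat k / of_nat d = of_int z"
    by (auto elim: Ints_cases)
  have "(of_nat k :: rat) = of_nat (residue m) + of_nat d * of_int (quotient m + z)"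
    using z d_pos by (simp add: slope_eq field_simps)
  then have "(of_int (int k) :: rat) = of_int (int (residue m) + int d * (quotient m + z))"
    by simp
  then have eq: "int k = int (residue m) + int d * (quotient m + z)"
    by (simp only: of_int_eq_iff)
  \<comment> \<open>Two numbers in \<open>{1..d}\<close> differ by less than
    \<open>d\<close>.\<close>
  then have "\<bar>int d * (quotient m + z)\<bar> < int d"
    using assms residue_range[of m] by auto
  then have "quotient m + z = 0"
    using d_pos by (simp add: abs_mult)
  with eq show "k = residue m" by simp
next
  assume "k = residue m"
  then show "- slope m + of_nat k / of_nat d \<in> \<int>"
    by (simp add: slope_eq)
qed

abbreviation gamma_product :: "(nat \<Rightarrow> nat) \<Rightarrow> rat" where
  "gamma_product m \<equiv> gamma_factor (of_nat (residue m) / of_nat d - 1) (1 + quotient m - int (total m)) *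
     gamma_factor (- of_nat (residue m) / of_nat d) (- quotient m)"

text \<open>The shift of the first gamma factor produces 1/d. So the first bracket is the missing
  case k = 1 of the sum in \<open>X_series\<close>, where \<open>a_i1\<close> would be displayed
  twice; this explains why it has no factor 1/d of its own.\<close>

lemma bracket_first:
  assumes "multi_index m"
  shows "bracket n ((\<lambda>_. 0)(i1 := 1 / of_nat d, i2 := - 1 / of_nat d)) (exponent m) =
    (if residue m = 1 then gamma_product m / (of_nat d * (\<Prod>i\<in>I. fact (m i))) else 0)"
proof -
  let ?u = "(\<lambda>_. 0)(i1 := 1 / of_nat d, i2 := - 1 / of_nat d) :: nat \<Rightarrow> rat"
  have u: "?u i1 = 1 / of_nat d" "?u i2 = - 1 / of_nat d" using i12 by auto
  show ?thesis
  proof (cases "residue m = 1")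
    case True
    have "bracket n ?u (exponent m) = gamma_factor (1 / of_nat d) (quotient m - int (total m)) *
        gamma_factor (- 1 / of_nat d) (- quotient m) / (\<Prod>i\<in>I. fact (m i))"
      using bracket_exponent[OF admissible_first assms, unfolded u, of "quotient m - int (total m)" "- quotient m"]
      by (simp add: slope_eq True)
    also have "gamma_factor (1 / of_nat d) (quotient m - int (total m)) =
        1 / of_nat d * gamma_factor (1 / of_nat d - 1) (1 + quotient m - int (total m))"
      using gamma_factor_shift[of "1 / of_nat d" "quotient m - int (total m)"] d_pos
      by (simp add: algebra_simps)
    finally show ?thesis using True by (simp del: fun_upd_apply)
  next
    case False
    then have "- slope m - ?u i2 \<notin> \<int>"
      using slope_diff_Ints_iff[of 1 m] d_pos i12 by simp
    then have "bracket n ?u (exponent m) = 0" by (rule bracket_eq_0)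
    with False show ?thesis by (simp only: if_False)
  qed
qed

lemma bracket_middle:
  assumes "multi_index m" "k \<in> {2..d}"
  shows "bracket n ((\<lambda>_. 0)(i1 := (of_nat k - of_nat d) / of_nat d, i1 + k - 1 := 1,
      i2 := - of_nat k / of_nat d)) (exponent m) =
    (if residue m = k then gamma_product m / (\<Prod>i\<in>I. fact (m i)) else 0)"
proof -
  let ?u = "(\<lambda>_. 0)(i1 := (of_nat k - of_nat d) / of_nat d, i1 + k - 1 := 1,
      i2 := - of_nat k / of_nat d) :: nat \<Rightarrow> rat"
  have u: "?u i1 = of_nat k / of_nat d - 1" "?u i2 = - of_nat k / of_nat d"
    using i12 assms by (auto simp: diff_divide_distrib)
  show ?thesis
  proof (cases "residue m = k")
    case True
    show ?thesis
      using bracket_exponent[OF admissible_middle[OF assms(2)] assms(1), unfolded u,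
          of "1 + quotient m - int (total m)" "- quotient m"]
      by (simp add: slope_eq True)
  next
    case False
    then have "- slope m - ?u i2 \<notin> \<int>"
      using slope_diff_Ints_iff[of k m] assms unfolding u by simp
    then have "bracket n ?u (exponent m) = 0" by (rule bracket_eq_0)
    with False show ?thesis by (simp only: if_False)
  qed
qed

text \<open>The bracket does not display \<open>a_i2\<close>, so it needs an integral
  \<open>slope m\<close>, which is the case k = d with \<open>slope m\<close> equal to 1 +
  \<open>quotient m\<close>.\<close>

lemma bracket_last:
  assumes "multi_index m" "i1 > 0"
  shows "bracket n ((\<lambda>_. 0)(i1 - 1 := 1, i1 := - 1)) (exponent m) =
    (if residue m = d then gamma_factor (- 1) (2 + quotient m - int (total m)) *
       gamma_factor 0 (- quotient m - 1) / (\<Prod>i\<in>I. fact (m i)) else 0)"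
proof -
  let ?u = "(\<lambda>_. 0)(i1 - 1 := 1, i1 := - 1) :: nat \<Rightarrow> rat"
  have u: "?u i1 = - 1" "?u i2 = 0"
    using i12 assms by auto
  show ?thesis
  proof (cases "residue m = d")
    case True
    show ?thesis
      using bracket_exponent[OF admissible_last[OF assms(2)] assms(1), unfolded u,
          of "2 + quotient m - int (total m)" "- quotient m - 1"] d_pos
      by (simp add: slope_eq True)
  next
    case False
    have "- slope m + 1 \<notin> \<int>"
      using slope_diff_Ints_iff[of d m] False d_pos by simp
    then have "- slope m - ?u i2 \<notin> \<int>"
      unfolding u by (metis Ints_1 Ints_add diff_zero)
    then have "bracket n ?u (exponent m) = 0" by (rule bracket_eq_0)
    with False show ?thesis by (simp only: if_False)
  qed
qed

section \<open>Coefficients of the whole series\<close>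

lemma X_series_nonzero:
  assumes "X_series n i1 i2 \<xi> e \<noteq> 0"
  shows "\<exists>m. multi_index m \<and> e = exponent m"
proof (rule ccontr)
  assume none: "\<nexists>m. multi_index m \<and> e = exponent m"
  then have 0: "bracket n u e = 0" if "admissible u" for u
    using bracket_nonzero[OF that, of e] by blast
  have "X_series n i1 i2 \<xi> e = 0"
    using 0[OF admissible_first] 0[OF admissible_middle] 0[OF admissible_last]
    by (simp add: X_series_def Let_def flip: d_eq del: fun_upd_apply)
  with assms show False by simp
qed

lemma X_series_exponent:
  assumes "multi_index m"
  shows "X_series n i1 i2 \<xi> (exponent m) =
    (\<xi> ^ residue m * of_rat (gamma_product m) + (if i1 > 0 \<and> residue m = d
       then of_rat (gamma_factor (- 1) (2 + quotient m - int (total m)) * gamma_factor 0 (- quotient m - 1))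
       else 0)) / (of_nat d * (\<Prod>i\<in>I. fact (m i)))"
proof -
  let ?P = "(\<Prod>i\<in>I. fact (m i)) :: complex"
  let ?G = "of_rat (gamma_product m) :: complex"
  have P: "of_rat (\<Prod>i\<in>I. fact (m i)) = ?P"
    by (simp add: of_rat_prod fact_prod)
  have "(\<Sum>k=2..d. \<xi> ^ k * of_rat (bracket n ((\<lambda>_. 0)(i1 := (of_nat k - of_nat d) / of_nat d,
        i1 + k - 1 := 1, i2 := - of_nat k / of_nat d)) (exponent m))) =
      (\<Sum>k=2..d. if residue m = k then \<xi> ^ k * (?G / ?P) else 0)"
    using bracket_middle[OF assms]
    by (intro sum.cong refl) (simp add: of_rat_divide P del: fun_upd_apply)
  \<comment> \<open>Residues lie in \<open>{1..d}\<close>, so the sum from 2 misses only residue 1,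
    which belongs to the first bracket.\<close>
  also have "\<dots> = (if residue m = 1 then 0 else \<xi> ^ residue m * (?G / ?P))"
    using residue_range[of m] by auto
  finally have middle: "(\<Sum>k=2..d. \<xi> ^ k * of_rat (bracket n ((\<lambda>_. 0)(i1 := (of_nat k - of_nat d) / of_nat d,
        i1 + k - 1 := 1, i2 := - of_nat k / of_nat d)) (exponent m))) =
      (if residue m = 1 then 0 else \<xi> ^ residue m * (?G / ?P))" .
  have first: "of_rat (bracket n ((\<lambda>_. 0)(i1 := 1 / of_nat d, i2 := - 1 / of_nat d)) (exponent m)) =
      (if residue m = 1 then ?G / (of_nat d * ?P) else 0)"
    unfolding bracket_first[OF assms] by (simp only: of_rat_divide of_rat_mult P of_rat_of_nat_eq of_rat_0 split: if_split) simp
  have last: "(if i1 = 0 then 0 else of_rat (bracket n ((\<lambda>_. 0)(i1 - 1 := 1, i1 := - 1)) (exponent m))) =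
      (if i1 > 0 \<and> residue m = d then of_rat (gamma_factor (- 1) (2 + quotient m - int (total m)) *
         gamma_factor 0 (- quotient m - 1)) / ?P else 0)"
    using bracket_last[OF assms] by (simp add: of_rat_divide P del: fun_upd_apply)
  have X: "X_series n i1 i2 \<xi> (exponent m) =
      \<xi> * (if residue m = 1 then ?G / (of_nat d * ?P) else 0) +
      1 / of_nat d * (if residue m = 1 then 0 else \<xi> ^ residue m * (?G / ?P)) +
      1 / of_nat d * (if i1 > 0 \<and> residue m = d
         then of_rat (gamma_factor (- 1) (2 + quotient m - int (total m)) *
           gamma_factor 0 (- quotient m - 1)) / ?P else 0)"
    unfolding X_series_def Let_def d_eq[symmetric] first middle last ..
  have collect: "\<xi> * (if b then G / (D * P) else 0) + 1 / D * (if b then 0 else z * (G / P)) +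
      1 / D * (if c then L / P else 0) = (z * G + (if c then L else 0)) / (D * P)"
    if "b \<Longrightarrow> z = \<xi>" for b c and z G L D P :: complex
    using that by (cases b; cases c) (auto simp: add_divide_distrib)
  show ?thesis
    unfolding X by (rule collect) simp
qed

text \<open>The constant term is separate: for \<open>total m = 0\<close> truncated subtraction
  makes the product formula for positive degree yield \<open>\<xi>\<close> / d instead of
  \<open>\<xi>\<close>.\<close>

lemma X_series_zero_exponent:
  assumes "multi_index m" "total m = 0"
  shows "X_series n i1 i2 \<xi> (exponent m) = \<xi>"
proof -
  have m0: "m i = 0" if "i \<in> I" for i
    using assms(2) that by (auto simp: total_def)
  then have "weight m = 0" by (simp add: weight_def)
  then have [simp]: "quotient m = 0" "residue m = 1"
    by (simp_all add: quotient_def residue_def)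
  have "gamma_factor (1 / of_nat d - 1) 1 * (1 / of_nat d) = 1"
    using gamma_factor_rec[of "1 / of_nat d - 1" 0] d_pos by simp
  then have G: "gamma_factor (1 / of_nat d - 1) 1 = of_nat d"
    using d_pos by (simp add: field_simps)
  show ?thesis
    using d_pos m0
    by (simp add: X_series_exponent assms G gamma_factor_zero_neg)
qed

lemma X_series_pos_exponent:
  assumes m: "multi_index m" "total m > 0" and \<xi>: "\<xi> ^ d = - 1"
  shows "X_series n i1 i2 \<xi> (exponent m) = \<xi> powi (weight m + 1) *
    of_rat (\<Prod>l=1..total m - 1. slope m - of_nat l) / (of_nat d * (\<Prod>i\<in>I. fact (m i)))"
proof -
  define Q where "Q = (\<Prod>l=1..total m - 1. slope m - of_nat l)"
  define q where "q = quotient m"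
  define \<kappa> :: rat where "\<kappa> = of_nat (residue m) / of_nat d"
  have \<kappa>: "0 < \<kappa>" "\<kappa> \<le> 1" "\<kappa> = 1 \<longleftrightarrow> residue m = d"
    using residue_range[of m] d_pos by (auto simp: \<kappa>_def)
  have slope: "slope m = \<kappa> + of_int q"
    by (simp add: slope_eq \<kappa>_def q_def)
  have nz: "\<kappa> + of_int z \<noteq> 0" if "\<kappa> < 1" for z
  proof
    assume "\<kappa> + of_int z = 0"
    then have "of_int (- z) = \<kappa>" by simp
    then have "(0::rat) < of_int (- z)" "of_int (- z) < (1::rat)" using \<kappa> that by auto
    then show False by simp
  qed
  \<comment> \<open>The second argument is q - (M-1) with M = \<open>total m\<close>, so M-1
    recursion steps lead to the argument \<open>q\<close> of the reflection formula.\<close>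
  have "gamma_factor (\<kappa> - 1) (1 + q - int (total m)) = gamma_factor (\<kappa> - 1) q * Q"
  proof -
    have "\<kappa> - 1 \<ge> 0 \<or> (\<forall>l\<in>{1..total m - 1}. \<kappa> - 1 + of_int q + 1 - of_nat l \<noteq> 0)"
    proof (cases "\<kappa> < 1")
      case True
      have "\<kappa> - 1 + of_int q + 1 - of_nat l = \<kappa> + of_int (q - int l)" for l by simp
      then show ?thesis using nz[OF True] by metis
    qed simp
    from gamma_factor_diff_nat[OF this] show ?thesis
      using m(2) by (simp add: Q_def slope of_nat_diff algebra_simps)
  qed
  then have G: "gamma_product m = (if q \<ge> 0 \<or> \<kappa> < 1 then (- 1) powi q else 0) * Q"
    using gamma_factor_reflection[OF \<kappa>(1,2), of q] by (simp add: \<kappa>_def q_def mult_ac)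
  have "\<xi> \<noteq> 0" using \<xi> d_pos by (auto simp: zero_power)
  then have pow: "\<xi> powi (weight m + 1) = \<xi> ^ residue m * (- 1) powi q"
    by (simp add: weight_eq q_def[symmetric] power_int_add power_int_mult \<xi>)
  have sgn: "of_rat ((- 1) powi z) = ((- 1) powi z :: complex)" for z
    by (cases "even z") auto
  \<comment> \<open>For negative \<open>q\<close> this is reflection at \<open>u = 1\<close> with -
    q - 1 >= 0 in the role of \<open>q\<close>, after M-1 recursion steps have split off
    \<open>Q\<close>.\<close>
  have G3: "gamma_factor (- 1) (2 + q - int (total m)) * gamma_factor 0 (- q - 1) =
      (if q \<ge> 0 then 0 else (- 1) powi (q + 1) * Q)" if "\<kappa> = 1"
  proof (cases "q \<ge> 0")
    case True
    then show ?thesis by (simp add: gamma_factor_zero_neg)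
  next
    case False
    have "- 1 + of_int (1 + q) + 1 - of_nat l \<noteq> (0 :: rat)" if "l \<in> {1..total m - 1}" for l
    proof -
      have "(of_int (1 + q - int l) :: rat) \<noteq> 0"
        using False that by (subst of_int_eq_0_iff) auto
      then show ?thesis by simp
    qed
    then have "gamma_factor (- 1) (2 + q - int (total m)) = gamma_factor (- 1) (1 + q) * Q"
      using gamma_factor_diff_nat[of "- 1" "total m - 1" "1 + q"] m(2) \<open>\<kappa> = 1\<close>
      by (simp add: Q_def slope of_nat_diff algebra_simps)
    moreover have "gamma_factor 0 (- q - 1) * gamma_factor (- 1) (1 + q) = (- 1) powi (q + 1)"
      using gamma_factor_reflection[of 1 "- q - 1"] False
      by (cases "even q") (simp_all add: add.commute)
    ultimately show ?thesis using False by (simp add: mult_ac)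
  qed
  \<comment> \<open>If i1 = 0, every variable has nonnegative weight, so the case that needs the
    last bracket cannot occur.\<close>
  have w: "q \<ge> 0" if "i1 = 0"
    unfolding q_def quotient_def weight_def using that d_pos
    by (intro pos_imp_zdiv_nonneg_iff[THEN iffD2] sum_nonneg) auto
  show ?thesis
  proof (cases "\<kappa> = 1")
    case False
    then have "\<kappa> < 1" "residue m \<noteq> d" using \<kappa> by auto
    then show ?thesis
      unfolding X_series_exponent[OF m(1)] G Q_def[symmetric] pow
      by (simp add: of_rat_mult sgn)
  next
    case True
    then have [simp]: "residue m = d" using \<kappa> by simp
    show ?thesis
    proof (cases "q \<ge> 0")
      case pos: True
      then show ?thesis
        unfolding X_series_exponent[OF m(1)] G Q_def[symmetric] pow
        unfolding q_def[symmetric] G3[OF True]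
        by (simp add: of_rat_mult sgn)
    next
      case neg: False
      \<comment> \<open>Only the last bracket contributes, and its sign
        \<open>(- 1) powi (q + 1)\<close> is \<open>\<xi> ^ d * (- 1) powi q\<close>.\<close>
      then have "i1 > 0" using w by auto
      with neg show ?thesis
        unfolding X_series_exponent[OF m(1)] G Q_def[symmetric] pow
        unfolding q_def[symmetric] G3[OF True]
        by (simp add: of_rat_mult of_rat_minus sgn True \<xi> power_int_add)
    qed
  qed
qed

end

section \<open>Comparison of the two series\<close>

lemma ex_count_list: "\<exists>js. count_list js = (m :: 'k::finite \<Rightarrow> nat)"
proof -
  obtain js where "mset js = Abs_multiset m"
    using ex_mset by blast
  then have "count_list js j = m j" for j
    by (metis count_Abs_multiset count_mset finite finite_code)
  then show ?thesis by blast
qed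

lemma sum_list_map_count_list:
  "sum_list (map f js) = (\<Sum>j\<in>UNIV. of_nat (count_list js j) * f j)"
  for f :: "'k::finite \<Rightarrow> 'a::comm_semiring_1"
proof (induction js)
  case (Cons j js)
  have "(\<Sum>i\<in>UNIV. of_nat (count_list (j # js) i) * f i) =
      (\<Sum>i\<in>UNIV. (if i = j then f i else 0) + of_nat (count_list js i) * f i)"
    by (intro sum.cong) (auto simp: algebra_simps)
  then show ?case by (simp add: sum.distrib Cons)
qed simp

text \<open>All lists with the given multiplicities have the same length and the same sum of the
  \<open>e j\<close>, so the formula for derivatives at 0 applies to whichever list is
  chosen.\<close>

lemma taylor_coeff_root:
  fixes w :: "complex^'k::finite \<Rightarrow> complex" and e :: "'k \<Rightarrow> int"
  assumes U: "open U" "0 \<in> U" and w: "csmooth_on U w"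
    and w0: "\<And>c. c \<in> U \<Longrightarrow> w c \<noteq> 0"
    and eq: "\<And>c. c \<in> U \<Longrightarrow> 1 + \<beta> * w c ^ d + (\<Sum>j\<in>UNIV. c $ j * w c powi e j) = 0"
    and d: "d > 0" and a: "a \<noteq> 0"
    and M: "M = (\<Sum>j\<in>UNIV. m j)" and T: "T = (\<Sum>j\<in>UNIV. int (m j) * e j) + 1"
  shows "taylor_coeff (\<lambda>c. w (\<chi> j. c $ j / a)) m =
    (if M = 0 then w 0
     else w 0 powi T / of_nat d * (\<Prod>l=1..M - 1. of_int T / of_nat d - of_nat l) / a ^ M) /
    (\<Prod>j\<in>UNIV. fact (m j))"
proof -
  define js where "js = (SOME js. count_list js = m)"
  have js: "count_list js = m"
    unfolding js_def by (rule someI_ex) (rule ex_count_list)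
  have len: "length js = M"
    using sum_list_map_count_list[of "\<lambda>_. 1 :: nat" js] by (simp add: js M sum_list_triv)
  have T': "T = 1 + sum_list (map e js)"
    by (simp add: sum_list_map_count_list js T)
  have vec0: "(\<chi> j. (0 :: complex^'k) $ j / a) = 0"
    by (simp add: vec_eq_iff)
  have scale: "cpartials js (\<lambda>c. w (\<chi> j. c $ j / a)) 0 = cpartials js w 0 / a ^ M"
    using cpartials_scale[OF U(1) w a, of 0 js] U(2) by (simp only: vec0 len)
  show ?thesis
  proof (cases js rule: rev_cases)
    case Nil
    then show ?thesis
      using scale len by (simp add: taylor_coeff_def flip: js_def)
  next
    case (snoc js' j)
    \<comment> \<open>The instance s = 1, which accounts for the summand 1 in \<open>T\<close>. The
      innermost derivative is not in \<open>js'\<close>, hence the product up to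
      \<open>M - 1\<close>.\<close>
    have "cpartials js w 0 = cpartials js' (\<lambda>c. w c powi (1 - 1) * cpartial j w c) 0"
      by (simp add: snoc cpartials_snoc)
    also have "\<dots> = w 0 powi T / of_nat d * (\<Prod>l=1..length js'. of_int T / of_nat d - of_nat l)"
      by (rule cpartials_root_at_0[OF U w w0 eq d]) (simp_all add: T' snoc)
    finally have "cpartials js w 0 =
      w 0 powi T / of_nat d * (\<Prod>l=1..length js'. of_int T / of_nat d - of_nat l)" .
    moreover have "length js' = M - 1" "M \<noteq> 0"
      using len snoc by auto
    ultimately show ?thesis
      unfolding taylor_coeff_def js_def[symmetric] scale by simp
  qed
qed

section \<open>Powers on the surface of the logarithm\<close>

lemma lpow_eq_exp: "lpow z \<gamma> = exp (\<gamma> * log_coord z)"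
  by (cases z) (simp add: algebra_simps)

lemma lpow_nonzero [simp]: "lpow z \<gamma> \<noteq> 0"
  by (simp add: lpow_eq_exp)

lemma lpow_add: "lpow z (\<gamma> + \<delta>) = lpow z \<gamma> * lpow z \<delta>"
  by (simp add: lpow_eq_exp distrib_right exp_add)

lemma lpow_minus: "lpow z (- \<gamma>) = inverse (lpow z \<gamma>)"
  by (simp add: lpow_eq_exp exp_minus)

text \<open>A point of the surface carries its logarithm, so fractional powers obey this law without
  any choice of a branch.\<close>

lemma lpow_of_int_mult: "lpow z (of_int k * \<gamma>) = lpow z \<gamma> powi k"
  by (simp add: lpow_eq_exp exp_power_int mult.assoc)

lemma lpow_of_int: "lpow z (of_int k) = lpow z 1 powi k"
  using lpow_of_int_mult[of z k 1] by simp

lemma lpow_of_nat: "lpow z (of_nat k) = lpow z 1 ^ k"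
  using lpow_of_int[of z "int k"] by simp

context root_series
begin

lemma exponent_reset:
  assumes "multi_index m"
  shows "(exponent m)(i1 := 0, i2 := 0) = (\<lambda>i. of_nat (m i))"
  using assms by (auto simp: fun_eq_iff exponent_def multi_index_def I_def)

text \<open>Exponents in the support are of the form \<open>exponent m\<close>, and \<open>m\<close>
  can be read off after the two special entries are reset; so one term remains.\<close>

lemma specialize_X_series:
  assumes "multi_index m"
  shows "specialize i1 i2 b1 b2 (X_series n i1 i2 \<xi>) (\<lambda>i. of_nat (m i)) =
    X_series n i1 i2 \<xi> (exponent m) * lpow b1 (of_rat (slope m - of_nat (total m))) *
      lpow b2 (of_rat (- slope m))"
proof -
  have unique: "e = exponent m"
    if e: "X_series n i1 i2 \<xi> e \<noteq> 0" "e(i1 := 0, i2 := 0) = (\<lambda>i. of_nat (m i))" for e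
  proof -
    obtain m' where m': "multi_index m'" "e = exponent m'"
      using X_series_nonzero[OF e(1)] by blast
    have "(\<lambda>i. of_nat (m' i) :: rat) = (\<lambda>i. of_nat (m i))"
      using e(2) m' by (simp only: exponent_reset)
    then have "m' = m" by (simp add: fun_eq_iff)
    with m' show ?thesis by simp
  qed
  have "specialize i1 i2 b1 b2 (X_series n i1 i2 \<xi>) (\<lambda>i. of_nat (m i)) =
      (\<Sum>e\<in>{exponent m}. X_series n i1 i2 \<xi> e * lpow b1 (of_rat (e i1)) * lpow b2 (of_rat (e i2)))"
    unfolding specialize_def using unique exponent_reset[OF assms]
    by (intro sum.mono_neutral_left) (auto simp del: fun_upd_apply)
  moreover have "exponent m i1 = slope m - of_nat (total m)" "exponent m i2 = - slope m"
    using i12 by (auto simp: exponent_def)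
  ultimately show ?thesis by simp
qed

lemma specialize_X_series_eq_0:
  assumes "\<nexists>m. multi_index m \<and> w = (\<lambda>i. of_nat (m i))"
  shows "specialize i1 i2 b1 b2 (X_series n i1 i2 \<xi>) w = 0"
proof -
  have "X_series n i1 i2 \<xi> e = 0" if "e(i1 := 0, i2 := 0) = w" for e
    using X_series_nonzero[of \<xi> e] exponent_reset that assms by metis
  then show ?thesis
    unfolding specialize_def by (intro sum.neutral) auto
qed

end

lemma taylor_series_multi_index:
  assumes "\<And>i. i \<notin> range idx \<Longrightarrow> m i = 0"
  shows "taylor_series idx F (\<lambda>i. of_nat (m i)) = taylor_coeff F (\<lambda>j. m (idx j))"
proof -
  have "{m'. (\<forall>j. (of_nat (m (idx j)) :: rat) = of_nat (m' j)) \<and>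
      (\<forall>i. i \<notin> range idx \<longrightarrow> (of_nat (m i) :: rat) = 0)} = {\<lambda>j. m (idx j)}"
    using assms by auto
  then show ?thesis by (simp add: taylor_series_def)
qed

lemma taylor_series_eq_0:
  assumes "inj idx"
    and "\<nexists>m. (\<forall>i. i \<notin> range idx \<longrightarrow> m i = 0) \<and> w = (\<lambda>i. of_nat (m i :: nat))"
  shows "taylor_series idx F w = 0"
proof -
  have False if m': "\<And>j. w (idx j) = of_nat (m' j)" "\<And>i. i \<notin> range idx \<Longrightarrow> w i = 0" for m'
  proof -
    define m where "m = (\<lambda>i. if i \<in> range idx then m' (inv idx i) else 0)"
    have "w = (\<lambda>i. of_nat (m i))"
      using m' by (fastforce simp: m_def fun_eq_iff inv_f_f[OF assms(1)])
    moreover have "m i = 0" if "i \<notin> range idx" for i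
      using that by (simp add: m_def)
    ultimately show False using assms(2) by blast
  qed
  then have "{m'. (\<forall>j. w (idx j) = of_nat (m' j)) \<and> (\<forall>i. i \<notin> range idx \<longrightarrow> w i = 0)} = {}"
    by blast
  then show ?thesis by (simp only: taylor_series_def sum.empty)
qed

theorem corollary5p5:
  fixes n i1 i2 d :: nat
    and idx :: "'k::finite \<Rightarrow> nat"
    and c1 c2 \<xi> :: complex
    and g :: "real \<times> real \<times> int \<Rightarrow> complex"
    and f :: "complex^'k \<Rightarrow> real \<times> real \<times> int \<Rightarrow> complex"
    and U :: "(complex^'k) set"
    and \<phi> :: "complex^'k \<Rightarrow> real \<times> real \<times> int"
    and \<alpha> b1 b2 :: "real \<times> real \<times> int"
  assumes "n \<ge> 2" and "i1 < i2" and "i2 \<le> n" and "d = i2 - i1"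
    and "bij_betw idx UNIV ({0..n} - {i1, i2})"
    and "c1 \<noteq> 0" and "c2 \<noteq> 0"
    and "\<And>z. z \<in> log_surface \<Longrightarrow> g z = 1 + c2 / c1 * lpow z (of_nat d)"
    and "\<And>c z. z \<in> log_surface \<Longrightarrow>
           f c z = g z + (\<Sum>j\<in>UNIV. c $ j * lpow z (of_int (int (idx j) - int i1)))"
    and "open U" and "0 \<in> U"
    and "smooth_to_log_surface U \<phi>"
    and "\<And>c. c \<in> U \<Longrightarrow> f c (\<phi> c) = 0"
    and "\<phi> 0 = \<alpha>" and "g \<alpha> = 0"
    and "b1 \<in> log_surface" and "lpow b1 1 = c1"
    and "b2 \<in> log_surface" and "lpow b2 1 = c2"
    and "\<xi> ^ d = - 1"
    and "lpow \<alpha> 1 = \<xi> * lpow b1 (1 / of_nat d) / lpow b2 (1 / of_nat d)"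
  shows "taylor_series idx (\<lambda>c. lpow (\<phi> (\<chi> j. c $ j / c1)) 1)
       = specialize i1 i2 b1 b2 (X_series n i1 i2 \<xi>)"
proof -
  interpret root_series n i1 i2 d
    using assms by unfold_locales
  define w where "w = (\<lambda>c. lpow (\<phi> c) 1)"
  define e where "e = (\<lambda>j. int (idx j) - int i1)"
  define F where "F = (\<lambda>c. lpow (\<phi> (\<chi> j. c $ j / c1)) 1)"
  have F: "F = (\<lambda>c. w (\<chi> j. c $ j / c1))" by (simp add: F_def w_def)
  have bij: "bij_betw idx UNIV I" and range: "range idx = I" and inj: "inj idx"
    using assms(5) by (auto simp: I_def bij_betw_def)
  \<comment> \<open>The formulas for \<open>f\<close> and \<open>g\<close> are given only on the
    surface. Continuity of \<open>\<phi>\<close> places its values in the topological space, whose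
    points are those of the surface.\<close>
  have \<phi>: "\<phi> c \<in> log_surface" if "c \<in> U" for c
  proof -
    have "\<phi> c \<in> topspace log_surface_topology"
      using assms(12) that unfolding smooth_to_log_surface_def continuous_map_def by auto
    then show ?thesis
      by (simp add: log_surface_topology_def topspace_pullback_topology)
  qed
  have root: "1 + c2 / c1 * w c ^ d + (\<Sum>j\<in>UNIV. c $ j * w c powi e j) = 0" if "c \<in> U" for c
    using assms(13)[OF that] assms(8)[OF \<phi>[OF that]] assms(9)[OF \<phi>[OF that], of c]
    by (simp add: w_def e_def lpow_of_nat flip: lpow_of_int)
  have coeff: "taylor_coeff F (\<lambda>j. m (idx j)) =
      (if total m = 0 then w 0
       else w 0 powi (weight m + 1) / of_nat d *
         (\<Prod>l=1..total m - 1. of_int (weight m + 1) / of_nat d - of_nat l) / c1 ^ total m) /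
      (\<Prod>i\<in>I. fact (m i))" for m
  proof -
    have "total m = (\<Sum>j\<in>UNIV. m (idx j))"
      unfolding total_def by (rule sum.reindex_bij_betw[OF bij, symmetric])
    moreover have "weight m + 1 = (\<Sum>j\<in>UNIV. int (m (idx j)) * e j) + 1"
      unfolding weight_def e_def by (simp add: sum.reindex_bij_betw[OF bij, symmetric])
    moreover have "(\<Prod>i\<in>I. fact (m i) :: complex) = (\<Prod>j\<in>UNIV. fact (m (idx j)))"
      by (rule prod.reindex_bij_betw[OF bij, symmetric])
    ultimately show ?thesis
      unfolding F using assms(12)
      by (subst taylor_coeff_root[OF assms(10,11) _ _ root d_pos assms(6)])
        (auto simp: w_def smooth_to_log_surface_def)
  qed
  have w0: "w 0 = \<xi> * lpow b1 (1 / of_nat d) * lpow b2 (- (1 / of_nat d))"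
    using assms(14,21) by (simp add: w_def lpow_minus divide_inverse)
  have slope: "of_rat (slope m) = of_int (weight m + 1) * (1 / of_nat d :: complex)" for m
    by (simp add: slope_def of_rat_divide of_rat_add)
  \<comment> \<open>The exponent 1/d of the two variables in the root becomes (t+1)/d, which is
    \<open>slope m\<close>.\<close>
  have w0_pow: "w 0 powi (weight m + 1) = \<xi> powi (weight m + 1) * lpow b1 (of_rat (slope m)) *
      lpow b2 (of_rat (- slope m))" for m
    unfolding w0 power_int_mult_distrib of_rat_minus slope lpow_minus lpow_of_int_mult
    by (simp add: power_int_inverse)
  have key: "taylor_coeff F (\<lambda>j. m (idx j)) = X_series n i1 i2 \<xi> (exponent m) *
      lpow b1 (of_rat (slope m - of_nat (total m))) * lpow b2 (of_rat (- slope m))"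
    if m: "multi_index m" for m
  proof -
    \<comment> \<open>The power of \<open>c1\<close> split off here is the one that rescaling the
      argument of \<open>\<phi>\<close> puts into the Taylor coefficient.\<close>
    have b1: "lpow b1 (of_rat (slope m - of_nat (total m))) = lpow b1 (of_rat (slope m)) / c1 ^ total m"
      using lpow_add[of b1 "of_rat (slope m)" "- of_nat (total m)"] assms(17)
      by (simp add: of_rat_diff lpow_minus lpow_of_nat divide_inverse)
    show ?thesis
    proof (cases "total m = 0")
      case True
      then have "m i = 0" if "i \<in> I" for i
        using that by (simp add: total_def)
      moreover from this have "weight m = 0"
        by (simp add: weight_def)
      ultimately show ?thesis
        using True slope[of m]
        by (simp add: coeff w0 X_series_zero_exponent[OF m] of_rat_minus)
    next
      case False
      have "of_rat (\<Prod>l=1..total m - 1. slope m - of_nat l) =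
          (\<Prod>l=1..total m - 1. of_int (weight m + 1) / of_nat d - of_nat l :: complex)"
        by (simp only: of_rat_prod of_rat_diff slope of_rat_of_nat_eq times_divide_eq_right mult_1_right)
      then show ?thesis
        using False X_series_pos_exponent[OF m _ assms(20)]
        by (simp add: coeff b1 w0_pow mult_ac)
    qed
  qed
  \<comment> \<open>At exponent vectors that are not multi-indices in the free variables both series
    vanish.\<close>
  have "taylor_series idx F v = specialize i1 i2 b1 b2 (X_series n i1 i2 \<xi>) v" for v
  proof (cases "\<exists>m. multi_index m \<and> v = (\<lambda>i. of_nat (m i))")
    case True
    then obtain m where m: "multi_index m" and v: "v = (\<lambda>i. of_nat (m i))" by blast
    show ?thesis
      unfolding v specialize_X_series[OF m] key[OF m, symmetric]
      using m range by (intro taylor_series_multi_index) (simp add: multi_index_def)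
  next
    case False
    then show ?thesis
      using taylor_series_eq_0[OF inj, of v F] specialize_X_series_eq_0[OF False]
      by (simp add: multi_index_def range)
  qed
  then show ?thesis
    by (auto simp: F_def)
qed

end
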